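(* Let $n>2$, and let $M$ and $\overline M$ be hypersurfaces of the pseudo-Euclidean space $\mathbb R_s^{n+1}$ whose induced metrics $g$ and $\bar g$ are (nondegenerate and) indefinite. Let $f:M\to\overline M$ be a bending preserving diffeomorphism, i.e. a diffeomorphism such that $$\overline K_{\bar h}(f_*x)=K_h(x)$$ for each nonzero nonisotropic tangent vector $x$ on $M$ whose image $f_*x$ is also nonisotropic. If the nonumbilic points are dense in $M$ and the curvature tensor $R$ of $M$ does not vanish identically at a point $p\in M$, then there exists a neighbourhood $V$ of $p$ such that $f|_V$ is a congruence of $V$ onto $f(V)$.
   Context: A hypersurface $M$ of $\mathbb R_s^{n+1}$ (so $\dim M=n$) is always assumed to be such that the restriction $g$ of the usual metric of $\mathbb R_s^{n+1}$ to $M$ is nondegenerate. $\nabla$ is the Levi-Civita connection, $R$ the curvature tensor (of type (0,4)) of $(M,g)$, and $h$ is the (scalar-valued) second fundamental form of $M$; the equations of Gauss and Codazzi are taken in the form $$R(X,Y,Z,U)=h(X,U)h(Y,Z)-h(X,Z)h(Y,U),\qquad (\nabla_Xh)(Y,Z)-(\nabla_Yh)(X,Z)=0 .$$ The corresponding objects for $\overline M$ are denoted with a bar ($\bar g,\bar h,\overline R,\dots$) and satisfy the same equations. A tangent vector $\xi$ is isotropic if $\xi\neq0$ and $g(\xi,\xi)=0$. The bending $K_h$ of $M$ is the function assigning to each nonzero nonisotropic tangent vector $x$ the number $K_h(x)=h(x,x)/g(x,x)$; $\overline K_{\bar h}$ is the bending of $\overline M$. A point $p\in M$ is umbilic if $h=\alpha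 g$ at $p$ for some real $\alpha$; otherwise it is nonumbilic. A diffeomorphism between hypersurfaces is a congruence if it can be extended to a motion (isometry) of $\mathbb R_s^{n+1}$. *)

theory Defs
  imports "HOL-Analysis.Analysis"
begin

section \<open>Smooth maps\<close>

text \<open>\<open>C_k_on k U f\<close> is the usual notion of class \<open>C\<^sup>k\<close> when \<open>U\<close> is open.\<close>

primrec C_k_on :: "nat \<Rightarrow> 'a::euclidean_space set \<Rightarrow> ('a \<Rightarrow> 'b::real_normed_vector) \<Rightarrow> bool" where
  "C_k_on 0 U f \<longleftrightarrow> continuous_on U f"
| "C_k_on (Suc k) U f \<longleftrightarrow>
     (\<forall>x\<in>U. f differentiable (at x)) \<and>
     (\<forall>v. C_k_on k U (\<lambda>x. frechet_derivative f (at x) v))"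

text \<open>Smoothness on an arbitrary subset of a Euclidean space: local extendability to a
  \<open>C\<^sup>\<infinity>\<close> map on an open set of the ambient space.\<close>

definition smooth_on :: "'a::euclidean_space set \<Rightarrow> ('a \<Rightarrow> 'b::real_normed_vector) \<Rightarrow> bool" where
  "smooth_on A f \<longleftrightarrow>
     (\<forall>p\<in>A. \<exists>W F. open W \<and> p \<in> W \<and> (\<forall>k. C_k_on k W F) \<and> (\<forall>x\<in>A \<inter> W. F x = f x))"

definition diffeomorphism ::
    "'a::euclidean_space set \<Rightarrow> 'b::euclidean_space set \<Rightarrow> ('a \<Rightarrow> 'b) \<Rightarrow> bool" where
  "diffeomorphism A B f \<longleftrightarrow>
     bij_betw f A B \<and> smooth_on A f \<and> smooth_on B (inv_into A f)"

section \<open>Pseudo-Euclidean space\<close>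

text \<open>The scalar product of \<open>\<real>\<^sub>s\<^sup>n\<^sup>+\<^sup>1\<close>, where \<open>S\<close> is the set of the \<open>s = card S\<close> coordinates
  that carry a minus sign.\<close>

definition pmetric :: "'N::finite set \<Rightarrow> real ^ 'N \<Rightarrow> real ^ 'N \<Rightarrow> real" where
  "pmetric S x y = (\<Sum>i\<in>UNIV. (if i \<in> S then -1 else 1) * (x $ i * y $ i))"

definition isotropic :: "'N::finite set \<Rightarrow> real ^ 'N \<Rightarrow> bool" where
  "isotropic S x \<longleftrightarrow> x \<noteq> 0 \<and> pmetric S x x = 0"

definition motion :: "'N::finite set \<Rightarrow> (real ^ 'N \<Rightarrow> real ^ 'N) \<Rightarrow> bool" where
  "motion S F \<longleftrightarrow>
     diffeomorphism UNIV UNIV F \<and>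
     (\<forall>p x y. pmetric S (frechet_derivative F (at p) x) (frechet_derivative F (at p) y)
               = pmetric S x y)"

section \<open>Hypersurfaces\<close>

definition local_param ::
    "(real ^ 'N) set \<Rightarrow> (real ^ 'n) set \<Rightarrow> (real ^ 'n \<Rightarrow> real ^ 'N) \<Rightarrow> bool" where
  "local_param M U \<phi> \<longleftrightarrow>
     open U \<and> openin (top_of_set M) (\<phi> ` U) \<and> diffeomorphism U (\<phi> ` U) \<phi>"

definition tangent_space :: "(real ^ 'N) set \<Rightarrow> real ^ 'N \<Rightarrow> (real ^ 'N) set" where
  "tangent_space M p =
     {v. \<exists>\<gamma> e. e > 0 \<and> smooth_on {-e<..<e} \<gamma> \<and> \<gamma> ` {-e<..<e} \<subseteq> M \<and> \<gamma> 0 = p \<and>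
               (\<gamma> has_vector_derivative v) (at (0::real))}"

text \<open>The induced metric on \<open>tangent_space M p\<close> is the restriction of \<open>pmetric S\<close>.\<close>

definition nondegenerate_metric :: "'N::finite set \<Rightarrow> (real ^ 'N) set \<Rightarrow> bool" where
  "nondegenerate_metric S M \<longleftrightarrow>
     (\<forall>p\<in>M. \<forall>x\<in>tangent_space M p. (\<forall>y\<in>tangent_space M p. pmetric S x y = 0) \<longrightarrow> x = 0)"

definition indefinite_metric :: "'N::finite set \<Rightarrow> (real ^ 'N) set \<Rightarrow> bool" where
  "indefinite_metric S M \<longleftrightarrow>
     (\<forall>p\<in>M. (\<exists>x\<in>tangent_space M p. pmetric S x x > 0) \<and>
            (\<exists>x\<in>tangent_space M p. pmetric S x x < 0))"

text \<open>The dimension \<open>n\<close> of the hypersurface is the cardinality of the index type \<open>'n\<close>.\<close>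

definition hypersurface :: "'n::finite itself \<Rightarrow> 'N::finite set \<Rightarrow> (real ^ 'N) set \<Rightarrow> bool" where
  "hypersurface _ S M \<longleftrightarrow>
     CARD('N) = CARD('n) + 1 \<and>
     (\<forall>p\<in>M. \<exists>(U :: (real ^ 'n) set) \<phi>. local_param M U \<phi> \<and> p \<in> \<phi> ` U) \<and>
     nondegenerate_metric S M"

text \<open>For \<open>f\<close> smooth on a hypersurface \<open>M\<close>, all Frechet derivatives of \<open>f\<close> at \<open>p\<close> within \<open>M\<close>
  agree on \<open>tangent_space M p\<close>; only there is the following meaningful.\<close>

definition pushforward ::
    "(real ^ 'N) set \<Rightarrow> (real ^ 'N \<Rightarrow> real ^ 'N) \<Rightarrow> real ^ 'N \<Rightarrow> real ^ 'N \<Rightarrow> real ^ 'N" where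
  "pushforward M f p = frechet_derivative f (at p within M)"

section \<open>Second fundamental form and bending\<close>

text \<open>The Gauss equation reads
  \<open>R(X,Y,Z,U) = \<epsilon> (h(X,U) h(Y,Z) - h(X,Z) h(Y,U))\<close> with \<open>\<epsilon> = \<langle>\<nu>,\<nu>\<rangle>\<close>. Two hypersurfaces satisfy it in
  the same form, with \<open>\<epsilon>\<close> absorbed into the sign convention for \<open>R\<close>, when they have the same
  \<open>\<epsilon>\<close>; hence \<open>\<epsilon>\<close> is an explicit parameter here.\<close>

definition unit_normal_field ::
    "'N::finite set \<Rightarrow> (real ^ 'N) set \<Rightarrow> real \<Rightarrow> (real ^ 'N \<Rightarrow> real ^ 'N) \<Rightarrow> bool" where
  "unit_normal_field S M \<epsilon> \<nu> \<longleftrightarrow>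
     \<epsilon> \<in> {1, -1} \<and> smooth_on M \<nu> \<and>
     (\<forall>p\<in>M. (\<forall>x\<in>tangent_space M p. pmetric S (\<nu> p) x = 0) \<and> pmetric S (\<nu> p) (\<nu> p) = \<epsilon>)"

text \<open>With \<open>D\<close> the flat connection of the ambient space, this is the \<open>h\<close> of the Gauss formula
  \<open>D\<^sub>X Y = \<nabla>\<^sub>X Y + h(X,Y) \<nu>\<close>: since \<open>\<langle>D\<^sub>X Y, \<nu>\<rangle> = - \<langle>D\<^sub>X \<nu>, Y\<rangle>\<close>, one has
  \<open>h(X,Y) = - \<langle>D\<^sub>X \<nu>, Y\<rangle> / \<langle>\<nu>, \<nu>\<rangle>\<close>.\<close>

definition second_fundamental_form ::
    "'N::finite set \<Rightarrow> (real ^ 'N) set \<Rightarrow> (real ^ 'N \<Rightarrow> real ^ 'N) \<Rightarrow>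
     real ^ 'N \<Rightarrow> real ^ 'N \<Rightarrow> real ^ 'N \<Rightarrow> real" where
  "second_fundamental_form S M \<nu> p x y =
     - pmetric S (frechet_derivative \<nu> (at p within M) x) y / pmetric S (\<nu> p) (\<nu> p)"

definition bending ::
    "'N::finite set \<Rightarrow> (real ^ 'N) set \<Rightarrow> (real ^ 'N \<Rightarrow> real ^ 'N) \<Rightarrow> real ^ 'N \<Rightarrow> real ^ 'N \<Rightarrow> real"
  where
  "bending S M \<nu> p x = second_fundamental_form S M \<nu> p x x / pmetric S x x"

definition umbilic ::
    "'N::finite set \<Rightarrow> (real ^ 'N) set \<Rightarrow> (real ^ 'N \<Rightarrow> real ^ 'N) \<Rightarrow> real ^ 'N \<Rightarrow> bool" where
  "umbilic S M \<nu> p \<longleftrightarrow>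
     (\<exists>\<alpha>. \<forall>x\<in>tangent_space M p. \<forall>y\<in>tangent_space M p.
        second_fundamental_form S M \<nu> p x y = \<alpha> * pmetric S x y)"

definition bending_preserving ::
    "'N::finite set \<Rightarrow> (real ^ 'N) set \<Rightarrow> (real ^ 'N \<Rightarrow> real ^ 'N) \<Rightarrow>
     (real ^ 'N) set \<Rightarrow> (real ^ 'N \<Rightarrow> real ^ 'N) \<Rightarrow> (real ^ 'N \<Rightarrow> real ^ 'N) \<Rightarrow> bool" where
  "bending_preserving S M \<nu> M' \<nu>' f \<longleftrightarrow>
     (\<forall>p\<in>M. \<forall>x\<in>tangent_space M p.
        x \<noteq> 0 \<and> \<not> isotropic S x \<and> \<not> isotropic S (pushforward M f p x) \<longrightarrow>
        bending S M' \<nu>' (f p) (pushforward M f p x) = bending S M \<nu> p x)"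

section \<open>Levi-Civita connection and curvature\<close>

definition partial :: "'n \<Rightarrow> (real ^ 'n \<Rightarrow> real) \<Rightarrow> real ^ 'n \<Rightarrow> real" where
  "partial i f u = frechet_derivative f (at u) (axis i 1)"

text \<open>For a metric with coordinate matrix \<open>G\<close>, \<open>christoffel G k i j\<close> is the \<open>\<partial>\<^sub>k\<close>-component of
  \<open>\<nabla>\<close>\<open>\<^bsub>\<partial>i\<^esub> \<partial>\<^sub>j\<close> for the Levi-Civita connection.\<close>

definition christoffel ::
    "(real ^ 'n \<Rightarrow> real ^ 'n ^ 'n) \<Rightarrow> 'n::finite \<Rightarrow> 'n \<Rightarrow> 'n \<Rightarrow> real ^ 'n \<Rightarrow> real" where
  "christoffel G k i j u =
     (\<Sum>l\<in>UNIV. matrix_inv (G u) $ k $ l *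
        (partial i (\<lambda>v. G v $ j $ l) u + partial j (\<lambda>v. G v $ i $ l) u
          - partial l (\<lambda>v. G v $ i $ j) u)) / 2"

text \<open>\<open>riemann_up G l i j k\<close> is the \<open>\<partial>\<^sub>l\<close>-component of \<open>R(\<partial>\<^sub>i,\<partial>\<^sub>j)\<partial>\<^sub>k\<close>, where
  \<open>R(X,Y)Z = \<nabla>\<^sub>X \<nabla>\<^sub>Y Z - \<nabla>\<^sub>Y \<nabla>\<^sub>X Z - \<nabla>\<close>\<open>\<^bsub>[X,Y]\<^esub> Z\<close>, and \<open>riemann G i j k l\<close> is
  \<open>R(\<partial>\<^sub>i,\<partial>\<^sub>j,\<partial>\<^sub>k,\<partial>\<^sub>l) = g(R(\<partial>\<^sub>i,\<partial>\<^sub>j)\<partial>\<^sub>k,\<partial>\<^sub>l)\<close>.\<close>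

definition riemann_up ::
    "(real ^ 'n \<Rightarrow> real ^ 'n ^ 'n) \<Rightarrow> 'n::finite \<Rightarrow> 'n \<Rightarrow> 'n \<Rightarrow> 'n \<Rightarrow> real ^ 'n \<Rightarrow> real" where
  "riemann_up G l i j k u =
     partial i (christoffel G l j k) u - partial j (christoffel G l i k) u
     + (\<Sum>m\<in>UNIV. christoffel G l i m u * christoffel G m j k u
                  - christoffel G l j m u * christoffel G m i k u)"

definition riemann ::
    "(real ^ 'n \<Rightarrow> real ^ 'n ^ 'n) \<Rightarrow> 'n::finite \<Rightarrow> 'n \<Rightarrow> 'n \<Rightarrow> 'n \<Rightarrow> real ^ 'n \<Rightarrow> real" where
  "riemann G i j k l u = (\<Sum>m\<in>UNIV. riemann_up G m i j k u * G u $ m $ l)"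

definition induced_metric ::
    "'N::finite set \<Rightarrow> (real ^ 'n \<Rightarrow> real ^ 'N) \<Rightarrow> real ^ 'n \<Rightarrow> real ^ 'n ^ 'n" where
  "induced_metric S \<phi> u =
     (\<chi> i j. pmetric S (frechet_derivative \<phi> (at u) (axis i 1))
                       (frechet_derivative \<phi> (at u) (axis j 1)))"

text \<open>The curvature tensor of \<open>M\<close> at \<open>p\<close>, for tangent vectors \<open>X, Y, Z, W\<close>: their coordinates
  with respect to a local parametrization around \<open>p\<close> are recovered with the inverse of its
  differential. The value does not depend on the chosen parametrization.\<close>

definition curvature_tensor ::
    "'n::finite itself \<Rightarrow> 'N::finite set \<Rightarrow> (real ^ 'N) set \<Rightarrow> real ^ 'N \<Rightarrow>
     real ^ 'N \<Rightarrow> real ^ 'N \<Rightarrow> real ^ 'N \<Rightarrow> real ^ 'N \<Rightarrow> real" where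
  "curvature_tensor _ S M p X Y Z W =
     (let (U, \<phi>) = (SOME (U :: (real ^ 'n) set, \<phi>). local_param M U \<phi> \<and> p \<in> \<phi> ` U);
          u = inv_into U \<phi> p;
          c = inv (frechet_derivative \<phi> (at u))
      in \<Sum>i\<in>UNIV. \<Sum>j\<in>UNIV. \<Sum>k\<in>UNIV. \<Sum>l\<in>UNIV.
           riemann (induced_metric S \<phi>) i j k l u * (c X $ i * c Y $ j * c Z $ k * c W $ l))"

section \<open>Congruences\<close>

definition congruence ::
    "'N::finite set \<Rightarrow> (real ^ 'N) set \<Rightarrow> (real ^ 'N) set \<Rightarrow> (real ^ 'N \<Rightarrow> real ^ 'N) \<Rightarrow> bool" where
  "congruence S V W f \<longleftrightarrow> diffeomorphism V W f \<and> (\<exists>F. motion S F \<and> (\<forall>x\<in>V. F x = f x))"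

end

theory Submission
  imports Defs
begin

text \<open>At a nonumbilic point the bending condition says \<open>h \<cdot> g' = h' \<cdot> g\<close> as quadratic polynomials on the
  tangent space (with \<open>g'\<close>, \<open>h'\<close> pulled back by \<open>f\<close>). Since \<open>g\<close> is irreducible for \<open>n > 2\<close> and does
  not divide \<open>h\<close>, it divides \<open>g'\<close>; so \<open>g' = \<lambda> g\<close> and \<open>h' = \<lambda> h\<close>, and by density this holds everywhere
  with a smooth \<open>\<lambda>\<close>, say \<open>\<lambda> = \<plusminus>exp (2\<phi>)\<close>. Comparing the two Codazzi equations shows that where
  \<open>d\<phi> \<noteq> 0\<close> the gradient \<open>G\<close> of \<open>\<phi>\<close> satisfies \<open>h(G,\<cdot>) = \<alpha> d\<phi>\<close> and \<open>h = \<alpha> g\<close> on \<open>ker d\<phi>\<close>, and that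
  \<open>G\<close> is isotropic at nonumbilic points, hence wherever it is nonzero. Comparing the two Gauss equations on
  \<open>R(G,X)G\<close> then gives \<open>(\<lambda> - 1) \<alpha>\<^sup>2 = 0\<close>, so where \<open>d\<lambda> \<noteq> 0\<close> and \<open>\<lambda> \<noteq> 1\<close> the form \<open>h\<close> has rank at
  most one and \<open>R = 0\<close>. Near a point with \<open>R \<noteq> 0\<close> the function \<open>\<lambda>\<close> is therefore locally constant, the
  Gauss equations force \<open>\<lambda> = 1\<close>, and the two hypersurfaces have the same fundamental forms.\<close>

section \<open>Smooth maps\<close>

text \<open>The factor \<lambda> may have either sign, so \<phi> itself never appears: only d\<phi>
  = d\<lambda> / (2 \<lambda>) is used, which is smooth and closed whatever the sign. That both
  hypersurfaces have the same \<epsilon> is decisive at the end. For constant \<lambda> the two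
  connections coincide, so the (0,4) curvature tensor is multiplied by \<lambda>, while the products
  of second fundamental forms are multiplied by the square of \<lambda>; with a common \<epsilon>
  only \<lambda> = 1 is left where the curvature is nonzero. The bending condition says nothing
  about null vectors, although the null cone is exactly where divisibility by g is decided. All
  arguments on forms are therefore polynomial identities, in which factors that vanish on a thin set
  can be cancelled.\<close>

definition dir :: "'a::real_normed_vector \<Rightarrow> ('a \<Rightarrow> 'b::real_normed_vector) \<Rightarrow> 'a \<Rightarrow> 'b" where
  "dir a f u = frechet_derivative f (at u) a"

definition C_inf_on :: "'a::euclidean_space set \<Rightarrow> ('a \<Rightarrow> 'b::real_normed_vector) \<Rightarrow> bool" where
  "C_inf_on U f \<longleftrightarrow> open U \<and> (\<forall>k. C_k_on k U f)"

lemma C_k_on_Suc: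
  "C_k_on (Suc k) U f \<longleftrightarrow> (\<forall>x\<in>U. f differentiable (at x)) \<and> (\<forall>v. C_k_on k U (dir v f))"
  by (simp add: dir_def[abs_def])

declare C_k_on.simps(2)[simp del]

lemma dir_eqI:
  assumes "(f has_derivative f') (at u)"
  shows "dir a f u = f' a"
  using frechet_derivative_at[OF assms] by (simp add: dir_def)

lemma has_derivative_dir:
  assumes "f differentiable (at u)"
  shows "(f has_derivative (\<lambda>a. dir a f u)) (at u)"
  using assms unfolding dir_def[abs_def] frechet_derivative_works by simp

lemma dir_transform:
  assumes "open U" "u \<in> U" "\<And>x. x \<in> U \<Longrightarrow> f x = g x" "f differentiable (at u)"
  shows "g differentiable (at u)" "dir a g u = dir a f u"
proof -
  have "(g has_derivative (\<lambda>a. dir a f u)) (at u)"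
    using has_derivative_transform_within_open[OF has_derivative_dir[OF assms(4)] assms(1,2)] assms(3)
    by blast
  then show "g differentiable (at u)" "dir a g u = dir a f u"
    using dir_eqI differentiable_def by blast+
qed

lemma dir_const: "dir a (\<lambda>x. c) u = 0"
  by (simp add: dir_def)

lemma dir_cong:
  assumes "open U" "u \<in> U" "\<And>x. x \<in> U \<Longrightarrow> f x = g x"
  shows "dir a f u = dir a g u"
proof -
  have "(f has_derivative f') (at u) \<longleftrightarrow> (g has_derivative f') (at u)" for f'
    using has_derivative_transform_within_open[OF _ assms(1,2), of f f' UNIV g]
      has_derivative_transform_within_open[OF _ assms(1,2), of g f' UNIV f] assms(3) by auto
  then show ?thesis by (simp add: dir_def frechet_derivative_def)
qed

lemma C_k_on_cong:
  assumes "open U" "\<And>x. x \<in> U \<Longrightarrow> f x = g x" "C_k_on k U f"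
  shows "C_k_on k U g"
  using assms
proof (induction k arbitrary: f g)
  case 0
  then show ?case using continuous_on_cong[of U U f g] by simp
next
  case (Suc k)
  show ?case unfolding C_k_on_Suc
  proof (intro conjI allI ballI)
    fix x assume "x \<in> U"
    then show "g differentiable (at x)"
      using dir_transform(1)[of U x f g] Suc.prems by (simp add: C_k_on_Suc)
  next
    fix v
    show "C_k_on k U (dir v g)"
    proof (rule Suc.IH)
      show "C_k_on k U (dir v f)" using Suc.prems by (simp add: C_k_on_Suc)
      fix x assume "x \<in> U"
      then show "dir v f x = dir v g x"
        using dir_transform(2)[of U x f g] Suc.prems by (simp add: C_k_on_Suc)
    qed (use Suc.prems in auto)
  qed
qed

lemma C_k_on_subset: "C_k_on k U f \<Longrightarrow> V \<subseteq> U \<Longrightarrow> C_k_on k V f"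
  by (induction k arbitrary: f) (auto simp: C_k_on_Suc intro: continuous_on_subset)

lemma C_k_on_local:
  assumes "\<And>x. x \<in> U \<Longrightarrow> \<exists>W. open W \<and> x \<in> W \<and> C_k_on k W f"
  shows "C_k_on k U f"
  using assms
proof (induction k arbitrary: f)
  case 0
  then show ?case
    by (metis C_k_on.simps(1) continuous_at_imp_continuous_on continuous_on_eq_continuous_at)
next
  case (Suc k)
  then show ?case unfolding C_k_on_Suc by meson
qed

lemma C_k_on_Suc_imp: "C_k_on (Suc k) U f \<Longrightarrow> C_k_on k U f"
proof (induction k arbitrary: f)
  case 0
  then show ?case
    by (auto simp: C_k_on_Suc intro!: continuous_at_imp_continuous_on differentiable_imp_continuous_within)
next
  case (Suc k)
  then show ?case using C_k_on_Suc by blast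
qed

lemma C_k_on_const [simp]: "C_k_on k U (\<lambda>x. c)"
proof (induction k arbitrary: c)
  case (Suc k)
  have "dir v (\<lambda>x::'a. c) = (\<lambda>x. 0)" for v
    by (auto simp: dir_def)
  then show ?case using Suc by (simp add: C_k_on_Suc)
qed simp

lemma C_k_on_linear:
  assumes "bounded_linear f"
  shows "C_k_on k U f"
proof (cases k)
  case 0
  then show ?thesis using assms by (simp add: linear_continuous_on)
next
  case (Suc j)
  have "(f has_derivative f) (at x)" for x
    by (rule bounded_linear_imp_has_derivative[OF assms])
  then have "dir v f = (\<lambda>x. f v)" "f differentiable (at x)" for v x
    by (auto simp: dir_eqI differentiable_def fun_eq_iff)
  then show ?thesis using Suc by (simp add: C_k_on_Suc)
qed

lemma dir_plus:
  assumes "f differentiable (at u)" "g differentiable (at u)"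
  shows "dir a (\<lambda>x. f x + g x) u = dir a f u + dir a g u"
  by (rule dir_eqI[OF has_derivative_add[OF has_derivative_dir has_derivative_dir]]) (use assms in auto)

lemma dir_bilinear:
  assumes "bounded_bilinear B" "f differentiable (at u)" "g differentiable (at u)"
  shows "dir a (\<lambda>x. B (f x) (g x)) u = B (f u) (dir a g u) + B (dir a f u) (g u)"
  by (rule dir_eqI[OF bounded_bilinear.FDERIV[OF assms(1) has_derivative_dir has_derivative_dir]])
    (use assms in auto)

lemma differentiable_bilinear:
  assumes "bounded_bilinear B" "f differentiable (at u)" "g differentiable (at u)"
  shows "(\<lambda>x. B (f x) (g x)) differentiable (at u)"
  using bounded_bilinear.FDERIV[OF assms(1) has_derivative_dir[OF assms(2)] has_derivative_dir[OF assms(3)]]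
  by (auto simp: differentiable_def)

lemma C_k_on_add:
  assumes "open U" "C_k_on k U f" "C_k_on k U g"
  shows "C_k_on k U (\<lambda>x. f x + g x)"
  using assms(2,3)
proof (induction k arbitrary: f g)
  case 0
  then show ?case by (auto intro: continuous_intros)
next
  case (Suc k)
  show ?case unfolding C_k_on_Suc
  proof (intro conjI allI ballI)
    fix v
    show "C_k_on k U (dir v (\<lambda>x. f x + g x))"
    proof (rule C_k_on_cong[OF assms(1)])
      show "C_k_on k U (\<lambda>x. dir v f x + dir v g x)"
        using Suc by (simp add: C_k_on_Suc)
    qed (use Suc.prems in \<open>simp add: C_k_on_Suc dir_plus\<close>)
  qed (use Suc.prems in \<open>auto simp add: C_k_on_Suc\<close>)
qed

text \<open>Stated for an arbitrary bilinear map, so that products, scalings, inner products and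
  later \<open>pmetric\<close> are all instances.\<close>

lemma C_k_on_bilinear:
  assumes "open U" "bounded_bilinear B" "C_k_on k U f" "C_k_on k U g"
  shows "C_k_on k U (\<lambda>x. B (f x) (g x))"
  using assms(3,4)
proof (induction k arbitrary: f g)
  case 0
  then show ?case using bounded_bilinear.continuous_on[OF assms(2)] by auto
next
  case (Suc k)
  show ?case unfolding C_k_on_Suc
  proof (intro conjI allI ballI)
    fix v
    show "C_k_on k U (dir v (\<lambda>x. B (f x) (g x)))"
    proof (rule C_k_on_cong[OF assms(1)])
      show "C_k_on k U (\<lambda>x. B (f x) (dir v g x) + B (dir v f x) (g x))"
        using Suc.prems C_k_on_Suc_imp[of k U f] C_k_on_Suc_imp[of k U g]
        by (intro C_k_on_add[OF assms(1)] Suc.IH) (auto simp: C_k_on_Suc)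
    qed (use Suc.prems in \<open>simp add: C_k_on_Suc dir_bilinear[OF assms(2)]\<close>)
  qed (use Suc.prems in \<open>auto simp add: C_k_on_Suc differentiable_bilinear[OF assms(2)]\<close>)
qed

lemma C_k_on_sum:
  assumes "open U" "\<And>i. i \<in> I \<Longrightarrow> C_k_on k U (f i)"
  shows "C_k_on k U (\<lambda>x. \<Sum>i\<in>I. f i x)"
  using assms by (induction I rule: infinite_finite_induct) (auto intro: C_k_on_add)

text \<open>The derivative of \<open>inverse (f x)\<close> is built from the derivative of
  \<open>f\<close> and \<open>inverse (f x)\<close> itself, so class k of the reciprocal yields
  class k + 1.\<close>

lemma C_k_on_inverse:
  fixes f :: "'a::euclidean_space \<Rightarrow> real"
  assumes "open U" "\<And>x. x \<in> U \<Longrightarrow> f x \<noteq> 0" "C_k_on k U f"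
  shows "C_k_on k U (\<lambda>x. inverse (f x))"
  using assms(3)
proof (induction k)
  case 0
  then show ?case using assms(2) by (auto intro!: continuous_intros)
next
  case (Suc k)
  have d: "((\<lambda>x. inverse (f x)) has_derivative (\<lambda>h. - (inverse (f x) * dir h f x * inverse (f x)))) (at x)"
    if "x \<in> U" for x
    by (rule Deriv.has_derivative_inverse[OF _ has_derivative_dir])
      (use Suc.prems that assms(2) in \<open>auto simp: C_k_on_Suc\<close>)
  have *: "C_k_on k U (\<lambda>x. - 1 * (inverse (f x) * dir v f x * inverse (f x)))" for v
    using Suc C_k_on_Suc_imp[OF Suc.prems]
    by (intro C_k_on_bilinear[OF assms(1) bounded_bilinear_mult] C_k_on_const)
      (auto simp: C_k_on_Suc)
  show ?case unfolding C_k_on_Suc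
  proof (intro conjI allI ballI)
    fix v
    show "C_k_on k U (dir v (\<lambda>x. inverse (f x)))"
      by (rule C_k_on_cong[OF assms(1) _ *[of v]]) (simp add: dir_eqI[OF d])
  qed (use d in \<open>auto simp: differentiable_def\<close>)
qed

text \<open>\<open>C_k_on\<close> controls derivatives in fixed directions, whereas the chain rule
  produces a direction that varies with the point. Expanding it in the basis moves the variation
  into scalar coefficients.\<close>

lemma dir_in_Basis:
  fixes f :: "'a::euclidean_space \<Rightarrow> 'b::real_normed_vector"
  assumes "f differentiable (at u)"
  shows "dir v f u = (\<Sum>i\<in>Basis. (v \<bullet> i) *\<^sub>R dir i f u)"
proof -
  have l: "linear (\<lambda>a. dir a f u)"
    using has_derivative_linear[OF has_derivative_dir[OF assms]] .
  have "dir v f u = dir (\<Sum>i\<in>Basis. (v \<bullet> i) *\<^sub>R i) f u"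
    by (simp add: euclidean_representation)
  also have "\<dots> = (\<Sum>i\<in>Basis. (v \<bullet> i) *\<^sub>R dir i f u)"
    by (simp add: linear_sum[OF l] linear_scale[OF l])
  finally show ?thesis .
qed

lemma C_k_on_compose:
  fixes f :: "'a::euclidean_space \<Rightarrow> 'b::euclidean_space" and g :: "'b \<Rightarrow> 'c::real_normed_vector"
  assumes "open U" "f ` U \<subseteq> W" "C_k_on k U f" "C_k_on k W g"
  shows "C_k_on k U (\<lambda>x. g (f x))"
  using assms(3,4)
proof (induction k arbitrary: g)
  case 0
  then show ?case using continuous_on_compose2 assms(2) by auto
next
  case (Suc k)
  have d: "((\<lambda>x. g (f x)) has_derivative (\<lambda>h. dir (dir h f x) g (f x))) (at x)" if "x \<in> U" for x
    using Suc.prems that assms(2)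
    by (intro has_derivative_compose[OF has_derivative_dir has_derivative_dir]) (auto simp: C_k_on_Suc)
  have *: "C_k_on k U (\<lambda>x. \<Sum>i\<in>Basis. (dir v f x \<bullet> i) *\<^sub>R dir i g (f x))" for v
    using Suc C_k_on_Suc_imp[of k U f]
    by (intro C_k_on_sum C_k_on_bilinear[OF assms(1) bounded_bilinear_scaleR]
        C_k_on_bilinear[OF assms(1) bounded_bilinear_inner] assms(1)) (auto simp: C_k_on_Suc)
  show ?case unfolding C_k_on_Suc
  proof (intro conjI allI ballI)
    fix v
    show "C_k_on k U (dir v (\<lambda>x. g (f x)))"
    proof (rule C_k_on_cong[OF assms(1) _ *[of v]])
      fix x assume x: "x \<in> U"
      then have "g differentiable (at (f x))" using Suc.prems assms(2) by (auto simp: C_k_on_Suc)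
      then show "(\<Sum>i\<in>Basis. (dir v f x \<bullet> i) *\<^sub>R dir i g (f x)) = dir v (\<lambda>x. g (f x)) x"
        using dir_eqI[OF d[OF x], of v] dir_in_Basis[of g "f x" "dir v f x"] by simp
    qed
  qed (use d in \<open>auto simp: differentiable_def\<close>)
qed

lemma C_inf_on_open: "C_inf_on U f \<Longrightarrow> open U"
  by (simp add: C_inf_on_def)

lemma C_inf_on_differentiable: "C_inf_on U f \<Longrightarrow> u \<in> U \<Longrightarrow> f differentiable (at u)"
  using C_k_on_Suc unfolding C_inf_on_def by blast

lemma C_inf_on_dir: "C_inf_on U f \<Longrightarrow> C_inf_on U (dir a f)"
  unfolding C_inf_on_def using C_k_on_Suc by blast

lemma C_inf_on_continuous: "C_inf_on U f \<Longrightarrow> continuous_on U f"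
  unfolding C_inf_on_def using C_k_on.simps(1) by blast

lemma C_inf_on_subset: "C_inf_on U f \<Longrightarrow> V \<subseteq> U \<Longrightarrow> open V \<Longrightarrow> C_inf_on V f"
  unfolding C_inf_on_def using C_k_on_subset by blast

lemma C_inf_on_cong:
  "C_inf_on U f \<Longrightarrow> (\<And>x. x \<in> U \<Longrightarrow> f x = g x) \<Longrightarrow> C_inf_on U g"
  unfolding C_inf_on_def using C_k_on_cong by blast

lemma C_inf_on_const: "open U \<Longrightarrow> C_inf_on U (\<lambda>x. c)"
  unfolding C_inf_on_def by simp

lemma C_inf_on_linear: "open U \<Longrightarrow> bounded_linear f \<Longrightarrow> C_inf_on U f"
  unfolding C_inf_on_def using C_k_on_linear by blast

lemma C_inf_on_add: "C_inf_on U f \<Longrightarrow> C_inf_on U g \<Longrightarrow> C_inf_on U (\<lambda>x. f x + g x)"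
  unfolding C_inf_on_def using C_k_on_add by blast

lemma C_inf_on_bilinear:
  "bounded_bilinear B \<Longrightarrow> C_inf_on U f \<Longrightarrow> C_inf_on U g \<Longrightarrow> C_inf_on U (\<lambda>x. B (f x) (g x))"
  unfolding C_inf_on_def using C_k_on_bilinear by blast

lemmas C_inf_on_mult = C_inf_on_bilinear[OF bounded_bilinear_mult]
lemmas C_inf_on_scaleR = C_inf_on_bilinear[OF bounded_bilinear_scaleR]

lemma C_inf_on_sum:
  "open U \<Longrightarrow> (\<And>i. i \<in> I \<Longrightarrow> C_inf_on U (f i)) \<Longrightarrow> C_inf_on U (\<lambda>x. \<Sum>i\<in>I. f i x)"
  by (simp add: C_inf_on_def C_k_on_sum)

lemma C_inf_on_prod:
  fixes f :: "'i \<Rightarrow> 'a::euclidean_space \<Rightarrow> real"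
  assumes "open U" "\<And>i. i \<in> I \<Longrightarrow> C_inf_on U (f i)"
  shows "C_inf_on U (\<lambda>x. \<Prod>i\<in>I. f i x)"
  using assms
  by (induction I rule: infinite_finite_induct) (auto intro: C_inf_on_mult C_inf_on_const)

lemma C_inf_on_inverse:
  fixes f :: "'a::euclidean_space \<Rightarrow> real"
  shows "C_inf_on U f \<Longrightarrow> (\<And>x. x \<in> U \<Longrightarrow> f x \<noteq> 0) \<Longrightarrow> C_inf_on U (\<lambda>x. inverse (f x))"
  unfolding C_inf_on_def using C_k_on_inverse by blast

lemma C_inf_on_divide:
  fixes f :: "'a::euclidean_space \<Rightarrow> real"
  assumes "C_inf_on U f" "C_inf_on U g" "\<And>x. x \<in> U \<Longrightarrow> g x \<noteq> 0"
  shows "C_inf_on U (\<lambda>x. f x / g x)"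
  using C_inf_on_mult[OF assms(1) C_inf_on_inverse[OF assms(2,3)]] by (simp add: field_class.field_divide_inverse)

lemma C_inf_on_compose:
  fixes f :: "'a::euclidean_space \<Rightarrow> 'b::euclidean_space"
  shows "C_inf_on U f \<Longrightarrow> C_inf_on W g \<Longrightarrow> f ` U \<subseteq> W \<Longrightarrow> C_inf_on U (\<lambda>x. g (f x))"
  unfolding C_inf_on_def using C_k_on_compose by blast

lemma C_inf_on_local:
  assumes "open U" "\<And>x. x \<in> U \<Longrightarrow> \<exists>W. x \<in> W \<and> C_inf_on W f"
  shows "C_inf_on U f"
  unfolding C_inf_on_def using C_k_on_local assms unfolding C_inf_on_def by meson

lemma C_inf_on_bounded_linear:
  fixes f :: "'a::euclidean_space \<Rightarrow> 'b::euclidean_space"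
  shows "bounded_linear L \<Longrightarrow> C_inf_on U f \<Longrightarrow> C_inf_on U (\<lambda>x. L (f x))"
  using C_inf_on_compose[of U f UNIV L] C_inf_on_linear[of UNIV L] by simp

lemma C_inf_on_vec_lambda:
  fixes f :: "'i::finite \<Rightarrow> 'a::euclidean_space \<Rightarrow> real"
  assumes "open U" "\<And>i. C_inf_on U (f i)"
  shows "C_inf_on U (\<lambda>x. \<chi> i. f i x)"
proof -
  have "C_inf_on U (\<lambda>x. \<Sum>i\<in>UNIV. f i x *\<^sub>R (axis i 1 :: real ^ 'i))"
    by (intro C_inf_on_sum C_inf_on_scaleR C_inf_on_const assms)
  moreover have "(\<Sum>i\<in>UNIV. f i x *\<^sub>R (axis i 1 :: real ^ 'i)) = (\<chi> i. f i x)" for x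
    using basis_expansion[of "\<chi> i. f i x"] by (simp add: scalar_mult_eq_scaleR)
  ultimately show ?thesis by simp
qed

section \<open>Smoothness of determinants and inverse matrices\<close>

lemma C_inf_on_det:
  fixes A :: "'a::euclidean_space \<Rightarrow> real ^ 'i ^ 'i"
  assumes "open U" "\<And>i j. C_inf_on U (\<lambda>x. A x $ i $ j)"
  shows "C_inf_on U (\<lambda>x. det (A x))"
  unfolding det_def
  by (intro C_inf_on_sum C_inf_on_prod C_inf_on_mult C_inf_on_const assms)

lemma matrix_mul_matrix_inv:
  fixes A :: "'a::semiring_1 ^ 'n ^ 'm"
  assumes "invertible A"
  shows "A ** matrix_inv A = mat 1" "matrix_inv A ** A = mat 1"
  using someI_ex[OF assms[unfolded invertible_def]] by (simp_all add: matrix_inv_def)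

text \<open>Cramer's rule for \<open>A *v x = axis l 1\<close>. It exhibits the entries of the
  inverse as rational functions of those of \<open>A\<close>, hence as smooth.\<close>

lemma matrix_inv_component:
  fixes A :: "real ^ 'i ^ 'i"
  assumes "invertible A"
  shows "matrix_inv A $ k $ l = det (\<chi> i j. if j = k then axis l 1 $ i else A $ i $ j) / det A"
proof -
  have d: "det A \<noteq> 0" using assms by (simp add: invertible_det_nz)
  have "A *v (matrix_inv A *v axis l 1) = axis l 1"
    using assms by (simp add: matrix_vector_mul_assoc matrix_mul_matrix_inv)
  then have "matrix_inv A *v axis l 1 = (\<chi> k. det (\<chi> i j. if j = k then axis l 1 $ i else A $ i $ j) / det A)"
    using cramer[OF d] by blast
  then have "(matrix_inv A *v axis l 1) $ k = det (\<chi> i j. if j = k then axis l 1 $ i else A $ i $ j) / det A"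
    by (metis (no_types, lifting) vec_lambda_beta)
  then show ?thesis
    by (simp add: matrix_vector_mul_component inner_axis)
qed

lemma C_inf_on_matrix_inv:
  fixes A :: "'a::euclidean_space \<Rightarrow> real ^ 'i ^ 'i"
  assumes "open U" "\<And>i j. C_inf_on U (\<lambda>x. A x $ i $ j)" "\<And>x. x \<in> U \<Longrightarrow> invertible (A x)"
  shows "C_inf_on U (\<lambda>x. matrix_inv (A x) $ k $ l)"
proof -
  have "C_inf_on U (\<lambda>x. (\<chi> i j. if j = k then axis l 1 $ i else A x $ i $ j) $ i $ j)" for i j
    using assms(2)[of i j] C_inf_on_const[OF assms(1)] by (cases "j = k") auto
  then have "C_inf_on U (\<lambda>x. det (\<chi> i j. if j = k then axis l 1 $ i else A x $ i $ j) / det (A x))"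
    by (intro C_inf_on_divide C_inf_on_det assms(1,2)) (use assms(3) in \<open>auto simp: invertible_det_nz\<close>)
  then show ?thesis
    by (rule C_inf_on_cong) (simp add: matrix_inv_component assms(3))
qed

text \<open>The second difference of \<open>f\<close> over the parallelogram spanned by
  \<open>r *\<^sub>R a\<close> and \<open>r *\<^sub>R b\<close> does not distinguish the two
  directions. Two uses of the mean value theorem turn it into \<open>r * r\<close> times a mixed
  derivative at a nearby point, in either order; continuity of both mixed derivatives does the
  rest.\<close>

lemma dir_symmetric_real:
  fixes f :: "'a::euclidean_space \<Rightarrow> real"
  assumes f: "C_inf_on U f" and u: "u \<in> U"
  shows "dir a (dir b f) u = dir b (dir a f) u"
proof -
  have U: "open U" using f C_inf_on_open by blast
  have mvt: "\<exists>s t. \<bar>s\<bar> \<le> r \<and> \<bar>t\<bar> \<le> r \<and>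
      f (u + r *\<^sub>R a + r *\<^sub>R b) - f (u + r *\<^sub>R a) - f (u + r *\<^sub>R b) + f u
        = r * r * dir b (dir a f) (u + s *\<^sub>R a + t *\<^sub>R b)"
    if r: "r > 0" and sub: "\<And>s t. \<bar>s\<bar> \<le> r \<Longrightarrow> \<bar>t\<bar> \<le> r \<Longrightarrow> u + s *\<^sub>R a + t *\<^sub>R b \<in> U" for a b r
  proof -
    have D1: "((\<lambda>s. f (u + s *\<^sub>R a + t *\<^sub>R b)) has_real_derivative dir a f (u + s *\<^sub>R a + t *\<^sub>R b)) (at s)"
      if "\<bar>s\<bar> \<le> r" "\<bar>t\<bar> \<le> r" for s t
    proof -
      have lin: "linear (\<lambda>c. dir c f (u + s *\<^sub>R a + t *\<^sub>R b))"
        using has_derivative_linear[OF has_derivative_dir[OF C_inf_on_differentiable[OF f sub[OF that]]]] .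
      have g: "((\<lambda>s. u + s *\<^sub>R a + t *\<^sub>R b) has_derivative (\<lambda>h. h *\<^sub>R a)) (at s)"
        by (auto intro!: derivative_eq_intros)
      have "((\<lambda>s. f (u + s *\<^sub>R a + t *\<^sub>R b)) has_derivative (\<lambda>h. dir (h *\<^sub>R a) f (u + s *\<^sub>R a + t *\<^sub>R b))) (at s)"
        by (rule has_derivative_compose[OF g has_derivative_dir[OF C_inf_on_differentiable[OF f sub[OF that]]]])
      then show ?thesis
        unfolding has_field_derivative_def using linear_scale[OF lin] by (simp add: mult_commute_abs)
    qed
    have D2: "((\<lambda>t. dir a f (u + s *\<^sub>R a + t *\<^sub>R b)) has_real_derivative dir b (dir a f) (u + s *\<^sub>R a + t *\<^sub>R b)) (at t)"
      if "\<bar>s\<bar> \<le> r" "\<bar>t\<bar> \<le> r" for s t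
    proof -
      note df = has_derivative_dir[OF C_inf_on_differentiable[OF C_inf_on_dir[OF f] sub[OF that]]]
      have lin: "linear (\<lambda>c. dir c (dir a f) (u + s *\<^sub>R a + t *\<^sub>R b))"
        using has_derivative_linear[OF df] .
      have g: "((\<lambda>t. u + s *\<^sub>R a + t *\<^sub>R b) has_derivative (\<lambda>h. h *\<^sub>R b)) (at t)"
        by (auto intro!: derivative_eq_intros)
      have "((\<lambda>t. dir a f (u + s *\<^sub>R a + t *\<^sub>R b)) has_derivative (\<lambda>h. dir (h *\<^sub>R b) (dir a f) (u + s *\<^sub>R a + t *\<^sub>R b))) (at t)"
        by (rule has_derivative_compose[OF g df])
      then show ?thesis
        unfolding has_field_derivative_def using linear_scale[OF lin] by (simp add: mult_commute_abs)
    qed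
    \<comment> \<open>The difference across the side \<open>b\<close>, as a function of the position
      along \<open>a\<close>. The mean value theorem in \<open>s\<close> leaves a difference of
      \<open>dir a f\<close>, to which it is applied again in \<open>t\<close>.\<close>
    let ?F = "\<lambda>s. f (u + s *\<^sub>R a + r *\<^sub>R b) - f (u + s *\<^sub>R a + 0 *\<^sub>R b)"
    obtain s where s: "0 < s" "s < r"
      "?F r - ?F 0 = (r - 0) * (dir a f (u + s *\<^sub>R a + r *\<^sub>R b) - dir a f (u + s *\<^sub>R a + 0 *\<^sub>R b))"
    proof -
      have "(?F has_real_derivative dir a f (u + s *\<^sub>R a + r *\<^sub>R b) - dir a f (u + s *\<^sub>R a + 0 *\<^sub>R b)) (at s)"
        if "0 \<le> s" "s \<le> r" for s
        by (intro DERIV_diff D1) (use that r in auto)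
      from MVT2[OF r this] show ?thesis using that by blast
    qed
    obtain t where t: "0 < t" "t < r"
      "dir a f (u + s *\<^sub>R a + r *\<^sub>R b) - dir a f (u + s *\<^sub>R a + 0 *\<^sub>R b) = (r - 0) * dir b (dir a f) (u + s *\<^sub>R a + t *\<^sub>R b)"
      using MVT2[OF r, of "\<lambda>t. dir a f (u + s *\<^sub>R a + t *\<^sub>R b)" "\<lambda>t. dir b (dir a f) (u + s *\<^sub>R a + t *\<^sub>R b)"]
        D2[of s] s by auto
    have "\<bar>s\<bar> \<le> r" "\<bar>t\<bar> \<le> r" using s t by auto
    with s(3) t(3) show ?thesis
      by (intro exI[of _ s] exI[of _ t]) (simp add: algebra_simps)
  qed
  have c1: "continuous_on U (dir a (dir b f))" and c2: "continuous_on U (dir b (dir a f))"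
    using C_inf_on_continuous C_inf_on_dir f by blast+
  show ?thesis
  proof (rule ccontr)
    assume ne: "dir a (dir b f) u \<noteq> dir b (dir a f) u"
    \<comment> \<open>Half the gap: numbers within \<open>e\<close> of the two different limits
      cannot be equal.\<close>
    define e where "e = \<bar>dir a (dir b f) u - dir b (dir a f) u\<bar> / 2"
    have e: "e > 0" using ne by (simp add: e_def)
    obtain d1 where d1: "d1 > 0" "\<And>x. x \<in> U \<Longrightarrow> dist x u < d1 \<Longrightarrow> \<bar>dir a (dir b f) x - dir a (dir b f) u\<bar> < e"
      using c1[unfolded continuous_on_iff] u e unfolding dist_real_def by meson
    obtain d2 where d2: "d2 > 0" "\<And>x. x \<in> U \<Longrightarrow> dist x u < d2 \<Longrightarrow> \<bar>dir b (dir a f) x - dir b (dir a f) u\<bar> < e"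
      using c2[unfolded continuous_on_iff] u e unfolding dist_real_def by meson
    obtain d3 where d3: "d3 > 0" "ball u d3 \<subseteq> U"
      using U u open_contains_ball by blast
    define d where "d = min d1 (min d2 d3)"
    have d: "d > 0" using d1 d2 d3 by (simp add: d_def)
    \<comment> \<open>Keeps all points with coefficients at most \<open>r\<close> within
      \<open>d\<close> of \<open>u\<close>; the summand 1 makes the denominator positive even if
      \<open>a\<close> and \<open>b\<close> vanish.\<close>
    define r where "r = d / (2 * (norm a + norm b + 1))"
    have na: "norm a + norm b + 1 > 0" by (simp add: add_nonneg_pos)
    have r: "r > 0" using d na by (simp add: r_def)
    have close: "dist (u + s *\<^sub>R a + t *\<^sub>R b) u < d" if "\<bar>s\<bar> \<le> r" "\<bar>t\<bar> \<le> r" for s t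
    proof -
      have "dist (u + s *\<^sub>R a + t *\<^sub>R b) u = norm (s *\<^sub>R a + t *\<^sub>R b)"
        by (simp add: dist_norm algebra_simps)
      also have "\<dots> \<le> \<bar>s\<bar> * norm a + \<bar>t\<bar> * norm b"
        by (metis norm_scaleR norm_triangle_ineq)
      also have "\<dots> \<le> r * norm a + r * norm b"
        using that by (intro add_mono mult_right_mono) auto
      also have "\<dots> < r * (2 * (norm a + norm b + 1))"
      proof -
        have "0 \<le> r * norm a" "0 \<le> r * norm b" using r by auto
        moreover have "r * (2 * (norm a + norm b + 1)) = r * norm a + r * norm b + (r * norm a + r * norm b + 2 * r)"
          by (simp add: algebra_simps)
        ultimately show ?thesis using r by linarith
      qed
      also have "\<dots> = d" using na by (simp add: r_def)
      finally show ?thesis .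
    qed
    have sub: "u + s *\<^sub>R a + t *\<^sub>R b \<in> U" if "\<bar>s\<bar> \<le> r" "\<bar>t\<bar> \<le> r" for s t
      using close[OF that] d3 by (auto simp: d_def dist_commute)
    have sub': "u + s *\<^sub>R b + t *\<^sub>R a \<in> U" if "\<bar>s\<bar> \<le> r" "\<bar>t\<bar> \<le> r" for s t
      using sub[OF that(2,1)] by (simp add: algebra_simps)
    obtain s t where st: "\<bar>s\<bar> \<le> r" "\<bar>t\<bar> \<le> r" 
      "f (u + r *\<^sub>R a + r *\<^sub>R b) - f (u + r *\<^sub>R a) - f (u + r *\<^sub>R b) + f u
        = r * r * dir b (dir a f) (u + s *\<^sub>R a + t *\<^sub>R b)"
      using mvt[OF r sub] by blast
    obtain s' t' where st': "\<bar>s'\<bar> \<le> r" "\<bar>t'\<bar> \<le> r" 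
      "f (u + r *\<^sub>R b + r *\<^sub>R a) - f (u + r *\<^sub>R b) - f (u + r *\<^sub>R a) + f u
        = r * r * dir a (dir b f) (u + s' *\<^sub>R b + t' *\<^sub>R a)"
      using mvt[OF r sub'] by blast
    have "r * r * dir b (dir a f) (u + s *\<^sub>R a + t *\<^sub>R b) = r * r * dir a (dir b f) (u + s' *\<^sub>R b + t' *\<^sub>R a)"
      using st(3) st'(3) by (simp add: algebra_simps)
    then have "dir b (dir a f) (u + s *\<^sub>R a + t *\<^sub>R b) = dir a (dir b f) (u + t' *\<^sub>R a + s' *\<^sub>R b)"
      using r by (simp add: algebra_simps)
    moreover have "\<bar>dir b (dir a f) (u + s *\<^sub>R a + t *\<^sub>R b) - dir b (dir a f) u\<bar> < e"
      using d2(2) sub close st by (simp add: d_def)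
    moreover have "\<bar>dir a (dir b f) (u + t' *\<^sub>R a + s' *\<^sub>R b) - dir a (dir b f) u\<bar> < e"
      using d1(2) sub close st' by (simp add: d_def)
    ultimately show False
      unfolding e_def by argo
  qed
qed

lemma dir_bounded_linear:
  assumes "bounded_linear L" "f differentiable (at u)"
  shows "dir a (\<lambda>x. L (f x)) u = L (dir a f u)"
  by (rule dir_eqI[OF bounded_linear.has_derivative[OF assms(1) has_derivative_dir[OF assms(2)]]])

lemma dir_symmetric:
  fixes f :: "'a::euclidean_space \<Rightarrow> 'b::euclidean_space"
  assumes f: "C_inf_on U f" and u: "u \<in> U"
  shows "dir a (dir b f) u = dir b (dir a f) u"
proof (rule euclidean_eqI)
  fix i :: 'b assume "i \<in> Basis"
  have L: "bounded_linear (\<lambda>y::'b. y \<bullet> i)" by (rule bounded_linear_inner_left)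
  have *: "dir a (dir b f) u \<bullet> i = dir a (dir b (\<lambda>x. f x \<bullet> i)) u" for a b
  proof -
    have "dir a (\<lambda>x. dir b f x \<bullet> i) u = dir a (dir b f) u \<bullet> i"
      using dir_bounded_linear[OF L] C_inf_on_dir[OF f] C_inf_on_differentiable u by blast
    moreover have "dir a (dir b (\<lambda>x. f x \<bullet> i)) u = dir a (\<lambda>x. dir b f x \<bullet> i) u"
    proof (rule dir_transform(2))
      show "open U" "u \<in> U" using f u C_inf_on_open by auto
      show "dir b f x \<bullet> i = dir b (\<lambda>x. f x \<bullet> i) x" if "x \<in> U" for x
        using dir_bounded_linear[OF L] f C_inf_on_differentiable that by metis
      show "(\<lambda>x. dir b f x \<bullet> i) differentiable at u"
        using C_inf_on_differentiable[OF C_inf_on_bounded_linear[OF L C_inf_on_dir[OF f]] u] .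
    qed
    ultimately show ?thesis by simp
  qed
  show "dir a (dir b f) u \<bullet> i = dir b (dir a f) u \<bullet> i"
    unfolding * by (rule dir_symmetric_real[OF C_inf_on_bounded_linear[OF L f] u])
qed

lemma dir_linear_arg:
  fixes f :: "'a::euclidean_space \<Rightarrow> 'b::euclidean_space"
  assumes "C_inf_on U f" "u \<in> U"
  shows "linear (\<lambda>a. dir a f u)"
  using has_derivative_linear[OF has_derivative_dir] C_inf_on_differentiable assms by blast


text \<open>In the last term the direction is frozen at \<open>u\<close> before differentiating. For
  a parametrization \<open>f\<close> and a tangent field \<open>w\<close> the terms are the change
  of the components and the second derivative of the parametrization, from which the connection is
  read off.\<close>

lemma dir_along:
  fixes f :: "'a::euclidean_space \<Rightarrow> 'b::euclidean_space"
  assumes f: "C_inf_on U f" and u: "u \<in> U" and w: "w differentiable (at u)"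
  shows "dir c (\<lambda>x. dir (w x) f x) u = dir (dir c w u) f u + dir c (dir (w u) f) u"
    and "(\<lambda>x. dir (w x) f x) differentiable (at u)"
proof -
  note d = C_inf_on_differentiable[OF _ u]
  have *: "((\<lambda>x. dir (w x) f x) has_derivative
      (\<lambda>c. \<Sum>i\<in>Basis. (w u \<bullet> i) *\<^sub>R dir c (dir i f) u + (dir c w u \<bullet> i) *\<^sub>R dir i f u)) (at u)"
    if "w differentiable (at u)" for w :: "'a \<Rightarrow> 'a"
  proof (rule has_derivative_transform_within_open)
    show "((\<lambda>x. \<Sum>i\<in>Basis. (w x \<bullet> i) *\<^sub>R dir i f x) has_derivative
      (\<lambda>c. \<Sum>i\<in>Basis. (w u \<bullet> i) *\<^sub>R dir c (dir i f) u + (dir c w u \<bullet> i) *\<^sub>R dir i f u)) (at u)"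
      by (intro has_derivative_sum has_derivative_scaleR has_derivative_dir d C_inf_on_dir f
          has_derivative_inner_left that)
    show "open U" "u \<in> U" using f u C_inf_on_open by auto
    show "(\<Sum>i\<in>Basis. (w x \<bullet> i) *\<^sub>R dir i f x) = dir (w x) f x" if "x \<in> U" for x
      using dir_in_Basis[of f x "w x"] C_inf_on_differentiable[OF f that] by simp
  qed
  have const: "dir c (\<lambda>x. w u) u = 0" by (simp add: dir_def)
  have "dir c (\<lambda>x. dir (w u) f x) u = (\<Sum>i\<in>Basis. (w u \<bullet> i) *\<^sub>R dir c (dir i f) u)"
    using dir_eqI[OF *[of "\<lambda>x. w u"]] const by simp
  moreover have "dir c (\<lambda>x. dir (w x) f x) u =
      (\<Sum>i\<in>Basis. (w u \<bullet> i) *\<^sub>R dir c (dir i f) u) + (\<Sum>i\<in>Basis. (dir c w u \<bullet> i) *\<^sub>R dir i f u)"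
    using dir_eqI[OF *[OF w]] by (simp add: sum.distrib)
  moreover have "dir (dir c w u) f u = (\<Sum>i\<in>Basis. (dir c w u \<bullet> i) *\<^sub>R dir i f u)"
    by (rule dir_in_Basis[OF d[OF f]])
  ultimately show "dir c (\<lambda>x. dir (w x) f x) u = dir (dir c w u) f u + dir c (dir (w u) f) u"
    by simp
  show "(\<lambda>x. dir (w x) f x) differentiable (at u)"
    using *[OF w] differentiable_def by blast
qed

lemma C_inf_on_dir_along:
  fixes f :: "'a::euclidean_space \<Rightarrow> 'b::euclidean_space"
  assumes f: "C_inf_on U f" and w: "C_inf_on U w"
  shows "C_inf_on U (\<lambda>x. dir (w x) f x)"
proof (rule C_inf_on_cong)
  show "C_inf_on U (\<lambda>x. \<Sum>i\<in>Basis. (w x \<bullet> i) *\<^sub>R dir i f x)"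
    by (intro C_inf_on_sum C_inf_on_scaleR C_inf_on_dir f C_inf_on_open[OF f]
        C_inf_on_bounded_linear[OF bounded_linear_inner_left w])
  show "(\<Sum>i\<in>Basis. (w x \<bullet> i) *\<^sub>R dir i f x) = dir (w x) f x" if "x \<in> U" for x
    using dir_in_Basis[of f x "w x"] C_inf_on_differentiable[OF f that] by simp
qed

section \<open>Quadratic forms\<close>

text \<open>On the line from \<open>y\<close> to \<open>x\<close> the factors become polynomials in
  one variable, nonzero at 0 and at 1 respectively if \<open>Q x \<noteq> 0\<close>; two finite zero
  sets cannot cover the line. This is the cancellation law for factors that vanish on a cone or a
  hyperplane.\<close>

lemma real_polynomial_function_domain:
  fixes P Q :: "'a::real_normed_vector \<Rightarrow> real"
  assumes P: "real_polynomial_function P" and Q: "real_polynomial_function Q"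
    and PQ: "\<And>x. P x * Q x = 0" and y: "P y \<noteq> 0"
  shows "Q x = 0"
proof (rule ccontr)
  assume x: "Q x \<noteq> 0"
  define l where "l = (\<lambda>t::real. y + t *\<^sub>R (x - y))"
  have l: "polynomial_function l"
    unfolding l_def
    by (intro polynomial_function_add polynomial_function_const polynomial_function_mult)
      (auto simp: real_polynomial_function_eq)
  have fin: "finite {t. (R \<circ> l) t = 0}" if R: "real_polynomial_function R" and "(R \<circ> l) s \<noteq> 0" for R s
  proof -
    have "real_polynomial_function (R \<circ> l)"
      using real_polynomial_function_compose[OF l R] by simp
    then obtain a k where ak: "R \<circ> l = (\<lambda>x. \<Sum>i\<le>k. a i * x ^ i)"
      using real_polynomial_function_imp_sum by blast
    then have "\<exists>i\<le>k. a i \<noteq> 0"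
      using that(2) by (auto intro: ccontr)
    then show ?thesis
      using polyfun_finite_roots[of a k] by (simp only: ak)
  qed
  have "(P \<circ> l) 0 \<noteq> 0" "(Q \<circ> l) 1 \<noteq> 0" using x y by (auto simp: l_def)
  then have "finite ({t. (P \<circ> l) t = 0} \<union> {t. (Q \<circ> l) t = 0})"
    using fin P Q by blast
  moreover have "{t. (P \<circ> l) t = 0} \<union> {t. (Q \<circ> l) t = 0} = UNIV"
    using PQ by auto
  ultimately show False using infinite_UNIV_char_0 by metis
qed

lemma real_polynomial_function_bilinear:
  fixes B :: "'b::euclidean_space \<Rightarrow> 'b \<Rightarrow> real"
  assumes B: "bounded_bilinear B" and f: "polynomial_function f" and g: "polynomial_function g"
  shows "real_polynomial_function (\<lambda>y. B (f y) (g y))"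
proof -
  have "real_polynomial_function (\<lambda>y. \<Sum>i\<in>Basis. (f y \<bullet> i) * B i (g y))"
  proof (intro real_polynomial_function_sum real_polynomial_function.intros(4))
    fix i :: 'b
    show "real_polynomial_function (\<lambda>y. f y \<bullet> i)"
      using f[unfolded polynomial_function_def, rule_format, OF bounded_linear_inner_left[of i]]
      by (simp add: comp_def)
    show "real_polynomial_function (\<lambda>y. B i (g y))"
      using g[unfolded polynomial_function_def, rule_format, OF bounded_bilinear.bounded_linear_right[OF B, of i]]
      by (simp add: comp_def)
  qed auto
  moreover have "B (f y) (g y) = (\<Sum>i\<in>Basis. (f y \<bullet> i) * B i (g y))" for y
  proof -
    have "B (f y) (g y) = B (\<Sum>i\<in>Basis. (f y \<bullet> i) *\<^sub>R i) (g y)"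
      by (simp add: euclidean_representation)
    also have "\<dots> = (\<Sum>i\<in>Basis. (f y \<bullet> i) * B i (g y))"
      by (simp add: bounded_bilinear.sum_left[OF B] bounded_bilinear.scaleR_left[OF B])
    finally show ?thesis .
  qed
  ultimately show ?thesis by simp
qed

section \<open>Symmetric bilinear forms and the null cone\<close>

locale sym_form =
  fixes B :: "'a::euclidean_space \<Rightarrow> 'a \<Rightarrow> real"
  assumes bilin: "bounded_bilinear B" and sym: "B x y = B y x"
begin

sublocale bounded_bilinear B by (rule bilin)

lemma polynomial: "polynomial_function f \<Longrightarrow> polynomial_function g \<Longrightarrow> real_polynomial_function (\<lambda>y. B (f y) (g y))"
  by (rule real_polynomial_function_bilinear[OF bilin])

lemma polynomial_quad: "real_polynomial_function (\<lambda>y. B y y)"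
  by (rule polynomial) auto

lemmas expand = add_left add_right diff_left diff_right scaleR_left scaleR_right

end

lemma polarization:
  assumes "sym_form B" "sym_form C" "\<And>x. B x x = r * C x x"
  shows "B x y = r * C x y"
proof -
  interpret B: sym_form B by fact
  interpret C: sym_form C by fact
  have "B (x + y) (x + y) = r * C (x + y) (x + y)" by (rule assms(3))
  then have "B x x + 2 * B x y + B y y = r * C x x + 2 * (r * C x y) + r * C y y"
    by (simp add: B.expand C.expand B.sym[of y x] C.sym[of y x] algebra_simps)
  then show ?thesis using assms(3)[of x] assms(3)[of y] by linarith
qed

locale pseudo_scalar_product = sym_form g for g :: "'a::euclidean_space \<Rightarrow> 'a \<Rightarrow> real" +
  assumes nondegenerate: "(\<And>y. g x y = 0) \<Longrightarrow> x = 0"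
begin

text \<open>Up to a factor, the inverse of the stereographic projection of the null cone from its point
  \<open>x0\<close>: the line through \<open>x0\<close> in direction \<open>y\<close> meets the cone again in a multiple of \<open>null_map x0 y\<close>. Being
  polynomial on the whole space, it replaces the irreducibility of the cone.\<close>

definition null_map :: "'a \<Rightarrow> 'a \<Rightarrow> 'a" where
  "null_map x0 y = g y y *\<^sub>R x0 - (2 * g x0 y) *\<^sub>R y"

lemma null_map_null: "g x0 x0 = 0 \<Longrightarrow> g (null_map x0 y) (null_map x0 y) = 0"
  by (simp add: null_map_def expand sym[of y x0] algebra_simps)

lemma polynomial_null_map: "polynomial_function (null_map x0)"
proof -
  have "polynomial_function (\<lambda>y. g y y)" "polynomial_function (\<lambda>y. 2 * g x0 y)"
    using polynomial_quad polynomial[of "\<lambda>_. x0" "\<lambda>y. y"] 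
    by (auto simp: real_polynomial_function_eq[symmetric] )
  then show ?thesis
    unfolding null_map_def[abs_def]
    by (intro polynomial_function_diff polynomial_function_mult) auto
qed

text \<open>Otherwise polarization makes the orthogonal complement of \<open>x0\<close> totally
  isotropic. In dimension above 2 some nonzero \<open>y\<close> is orthogonal to \<open>x0\<close>
  and to a vector \<open>e\<close> with \<open>g x0 e = 1\<close>; it is then orthogonal to the
  complement and to \<open>e\<close>, hence to everything.\<close>

lemma nonnull_orthogonal:
  assumes dim: "DIM('a) > 2" and x0: "x0 \<noteq> 0"
  shows "\<exists>y. g x0 y = 0 \<and> g y y \<noteq> 0"
proof (rule ccontr)
  assume "\<not> ?thesis"
  then have null: "g y y = 0" if "g x0 y = 0" for y using that by blast
  have null2: "g y z = 0" if "g x0 y = 0" "g x0 z = 0" for y z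
    using null[of "y + z"] null[of y] null[of z] that by (simp add: expand sym[of z y])
  obtain e' where "g x0 e' \<noteq> 0" using nondegenerate x0 by blast
  then obtain e where e: "g x0 e = 1"
    using scaleR_right[of x0 "inverse (g x0 e')" e'] by auto
  define L where "L = (\<lambda>y. (g x0 y, g e y))"
  have L: "linear L"
    by (rule linearI) (auto simp: L_def expand)
  have "\<not> inj L"
  proof
    assume "inj L"
    then have "dim (range L) = DIM('a)"
      using dim_image_eq[OF L, of UNIV] by (simp add: inj_on_subset)
    then show False using dim dim_subset_UNIV[of "range L"] by simp
  qed
  then obtain y where y: "L y = 0" "y \<noteq> 0"
    using linear_injective_0[OF L] by blast
  have "g y z = 0" for z
  proof -
    have "g x0 (z - g x0 z *\<^sub>R e) = 0" using e by (simp add: expand)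
    then have "g y (z - g x0 z *\<^sub>R e) = 0" using y null2 by (simp add: L_def zero_prod_def)
    then show ?thesis using y by (simp add: expand L_def zero_prod_def sym[of y e])
  qed
  then show False using y nondegenerate by blast
qed

text \<open>Inserting the definition of \<open>null_map\<close> gives an identity of degree 4 in
  \<open>y\<close>. It is divided by the linear form \<open>g x0\<close> twice; before each
  division, restriction to the hyperplane \<open>g x0 y = 0\<close> supplies what is needed, namely
  \<open>h x0 x0 = 0\<close> and then that \<open>h x0\<close> is a multiple of
  \<open>g x0\<close>.\<close>

lemma proportional_if_vanishes_on_null_map:
  assumes dim: "DIM('a) > 2" and x0: "x0 \<noteq> 0" and null: "g x0 x0 = 0"
    and "sym_form h" and van: "\<And>y. h (null_map x0 y) (null_map x0 y) = 0"
  shows "\<exists>\<alpha>. \<forall>x y. h x y = \<alpha> * g x y"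
proof -
  interpret h: sym_form h by fact
  have exp: "g y y * g y y * h x0 x0 - 4 * (g y y * g x0 y * h x0 y) + 4 * (g x0 y * g x0 y * h y y) = 0" for y
    using van[of y] by (simp add: null_map_def h.expand h.sym[of y x0] algebra_simps)
  obtain y1 where y1: "g x0 y1 = 0" "g y1 y1 \<noteq> 0"
    using nonnull_orthogonal[OF dim x0] by blast
  have h00: "h x0 x0 = 0" using exp[of y1] y1 by simp
  obtain e' where "g x0 e' \<noteq> 0" using nondegenerate x0 by blast
  then obtain e where e: "g x0 e = 1"
    using scaleR_right[of x0 "inverse (g x0 e')" e'] by auto
  note poly = polynomial_quad h.polynomial_quad polynomial[OF polynomial_function_const polynomial_function_id]
    h.polynomial[OF polynomial_function_const polynomial_function_id]
  have R: "g x0 y * h y y - g y y * h x0 y = 0" for y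
  proof (rule real_polynomial_function_domain[where P = "\<lambda>y. g x0 y" and Q = "\<lambda>y. g x0 y * h y y - g y y * h x0 y"])
    show "g x0 e \<noteq> 0" using e by simp
    show "g x0 y * (g x0 y * h y y - g y y * h x0 y) = 0" for y
      using exp[of y] h00 by (simp add: algebra_simps)
  qed (intro poly real_polynomial_function_diff real_polynomial_function.intros(4))+
  have perp': "h x0 y = 0" if "g x0 y = 0" "g y y \<noteq> 0" for y
    using R[of y] that by simp
  have perp: "h x0 y = 0" if y: "g x0 y = 0" for y
  proof -
    \<comment> \<open>If \<open>y\<close> is null, then \<open>y + y1\<close> or
      \<open>y - y1\<close> is not, since their values add up to \<open>2 * g y1 y1\<close>; the
      contribution of \<open>y1\<close> can be removed because \<open>h x0 y1 = 0\<close>.\<close>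
    have "g (y + y1) (y + y1) + g (y - y1) (y - y1) = 2 * g y y + 2 * g y1 y1"
      by (simp add: expand)
    then consider "g y y \<noteq> 0" | "g (y + y1) (y + y1) \<noteq> 0" | "g (y - y1) (y - y1) \<noteq> 0"
      using y1(2) by fastforce
    then show ?thesis
      using perp'[of y] perp'[of "y + y1"] perp'[of "y - y1"] perp'[of y1] y y1
      by cases (simp_all add: expand h.expand)
  qed
  have hx0: "h x0 z = h x0 e * g x0 z" for z
    using perp[of "z - g x0 z *\<^sub>R e"] e by (simp add: expand h.expand)
  have "h y y - h x0 e * g y y = 0" for y
  proof (rule real_polynomial_function_domain[where P = "\<lambda>y. g x0 y" and Q = "\<lambda>y. h y y - h x0 e * g y y"])
    show "g x0 e \<noteq> 0" using e by simp
    show "g x0 y * (h y y - h x0 e * g y y) = 0" for y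
      using R[of y] hx0[of y] by (simp add: algebra_simps)
  qed (intro poly real_polynomial_function_diff real_polynomial_function.intros(4) real_polynomial_function.intros(2))+
  note diag = this
  have "h x y = h x0 e * g x y" for x y
    by (rule polarization[OF \<open>sym_form h\<close> sym_form_axioms]) (use diag in simp)
  then show ?thesis by blast
qed

lemma null_vector_exists:
  assumes "g a a > 0" "g b b < 0"
  shows "\<exists>x. x \<noteq> 0 \<and> g x x = 0"
proof -
  \<comment> \<open>A quarter of the discriminant of
    \<open>g (a + t *\<^sub>R b) (a + t *\<^sub>R b)\<close> as a quadratic in \<open>t\<close>,
    positive because the outer coefficients have opposite signs.\<close>
  define D where "D = (g a b)\<^sup>2 - g a a * g b b"
  have D: "D > 0"
    using mult_pos_neg[OF assms] zero_le_power2[of "g a b"] unfolding D_def by linarith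
  define t where "t = (- g a b + sqrt D) / g b b"
  have "g b b * t + g a b = sqrt D" using assms by (simp add: t_def)
  then have "(g b b * t + g a b)\<^sup>2 = D" using D by simp
  then have "g b b * (g a a + 2 * t * g a b + t * t * g b b) = 0"
    by (simp add: D_def power2_eq_square algebra_simps)
  then have "g a a + 2 * t * g a b + t * t * g b b = 0" using assms by simp
  then have null: "g (a + t *\<^sub>R b) (a + t *\<^sub>R b) = 0"
    by (simp add: expand sym[of b a] algebra_simps)
  have "a + t *\<^sub>R b \<noteq> 0"
  proof
    assume "a + t *\<^sub>R b = 0"
    then have "a = (- t) *\<^sub>R b" by (simp add: eq_neg_iff_add_eq_0)
    then have "g a a = t * t * g b b" by (simp add: minus_left minus_right expand)
    moreover have "t * t * g b b \<le> 0" using assms by (simp add: mult_nonneg_nonpos)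
    ultimately show False using assms by linarith
  qed
  with null show ?thesis by blast
qed

text \<open>The hypothesis is silent when \<open>x\<close> is null for either metric, so the
  cross-multiplied identity is first proved with the extra factor \<open>g x x * g' x x\<close>,
  which is then cancelled. Along \<open>null_map\<close> it reduces to the vanishing of a product of
  \<open>h\<close> and \<open>g'\<close>. Being nonumbilic prevents \<open>h\<close> from vanishing
  there identically, so \<open>g'\<close> does.\<close>

lemma same_bending_imp_proportional:
  assumes dim: "DIM('a) > 2" and indef: "g a a > 0" "g b b < 0"
    and h: "sym_form h" and h': "sym_form h'" and g': "pseudo_scalar_product g'"
    and bend: "\<And>x. g x x \<noteq> 0 \<Longrightarrow> g' x x \<noteq> 0 \<Longrightarrow> h' x x / g' x x = h x x / g x x"
    and nonumb: "\<not> (\<exists>\<alpha>. \<forall>x y. h x y = \<alpha> * g x y)"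
  shows "\<exists>r. (\<forall>x y. g' x y = r * g x y) \<and> (\<forall>x y. h' x y = r * h x y)"
proof -
  interpret h: sym_form h by fact
  interpret h': sym_form h' by fact
  interpret g': pseudo_scalar_product g' by fact
  have "a \<noteq> 0" using indef zero_left by auto
  have ex: "\<exists>x. g' x x \<noteq> 0"
  proof (rule ccontr)
    assume neg: "\<not> ?thesis"
    have "g' x y = 0 * g x y" for x y
      by (rule polarization[OF g'.sym_form_axioms sym_form_axioms]) (use neg in simp)
    then show False using g'.nondegenerate[of a] \<open>a \<noteq> 0\<close> by simp
  qed
  note poly = polynomial_quad h.polynomial_quad g'.polynomial_quad h'.polynomial_quad
  have gg': "\<exists>x. g x x * g' x x \<noteq> 0"
    using real_polynomial_function_domain[OF polynomial_quad g'.polynomial_quad, of a] ex indef by fastforce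
  then obtain x1 where x1: "g x1 x1 * g' x1 x1 \<noteq> 0" by blast
  have id: "h x x * g' x x - h' x x * g x x = 0" for x
  proof (rule real_polynomial_function_domain[where P = "\<lambda>x. g x x * g' x x"
        and Q = "\<lambda>x. h x x * g' x x - h' x x * g x x", OF _ _ _ x1])
    show "g x x * g' x x * (h x x * g' x x - h' x x * g x x) = 0" for x
      using bend[of x] by (cases "g x x = 0"; cases "g' x x = 0") (auto simp: field_simps)
  qed (intro poly real_polynomial_function_diff real_polynomial_function.intros(4))+
  obtain x0 where x0: "x0 \<noteq> 0" "g x0 x0 = 0" using null_vector_exists[OF indef] by blast
  let ?w = "null_map x0"
  have prod: "h (?w y) (?w y) * g' (?w y) (?w y) = 0" for y
    using id[of "?w y"] null_map_null[OF x0(2), of y] by simp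
  have "\<exists>y. h (?w y) (?w y) \<noteq> 0"
    using proportional_if_vanishes_on_null_map[OF dim x0 h] nonumb by blast
  then have "g' (?w y) (?w y) = 0" for y
    using real_polynomial_function_domain[OF h.polynomial g'.polynomial, OF
        polynomial_null_map polynomial_null_map polynomial_null_map polynomial_null_map prod] by blast
  then obtain r where r: "\<And>x y. g' x y = r * g x y"
    using proportional_if_vanishes_on_null_map[OF dim x0 g'.sym_form_axioms] by blast
  have "h' x x - r * h x x = 0" for x
  proof (rule real_polynomial_function_domain[where P = "\<lambda>x. g x x" and Q = "\<lambda>x. h' x x - r * h x x"])
    show "g a a \<noteq> 0" using indef by simp
    show "g x x * (h' x x - r * h x x) = 0" for x
      using id[of x] r[of x x] by (auto simp: algebra_simps)
  qed (intro poly real_polynomial_function_diff real_polynomial_function.intros(4) real_polynomial_function.intros(2))+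
  note diag = this
  have "h' x y = r * h x y" for x y
    by (rule polarization[OF h' h]) (use diag in simp)
  with r show ?thesis by blast
qed

end

text \<open>\<open>star\<close> is what remains of the difference of two Codazzi equations. For
  \<open>\<phi> X = 1\<close> and \<open>\<phi> Y = 0\<close> the choice \<open>Z = G\<close> gives
  \<open>2 * h G Y = 0\<close>, and then general \<open>Z\<close> gives the first claim with
  \<alpha> = \<open>h G X\<close>. If \<open>\<phi> G \<noteq> 0\<close>, the vector
  \<open>G\<close> and the kernel of \<phi> span the space, which makes the point umbilic; so at
  nonumbilic points \<open>G\<close> is null.\<close>

lemma codazzi_algebra:
  assumes g: "sym_form g" and h: "sym_form h" and G: "\<And>a. g G a = \<phi> a"
    and star: "\<And>X Y Z. \<phi> X * h Y Z - \<phi> Y * h X Z + g X Z * h G Y - g Y Z * h G X = 0"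
    and nz: "\<phi> X0 \<noteq> 0"
  obtains \<alpha> where "\<And>Y Z. \<phi> Y = 0 \<Longrightarrow> h Y Z = \<alpha> * g Y Z" "\<And>Z. h G Z = \<alpha> * \<phi> Z"
    "\<phi> G \<noteq> 0 \<Longrightarrow> \<forall>x y. h x y = \<alpha> * g x y"
proof -
  interpret g: sym_form g by fact
  interpret h: sym_form h by fact
  define X where "X = inverse (\<phi> X0) *\<^sub>R X0"
  have \<phi>: "\<phi> (a + b) = \<phi> a + \<phi> b" "\<phi> (a - b) = \<phi> a - \<phi> b" "\<phi> (r *\<^sub>R a) = r * \<phi> a" for a b r
    by (simp_all add: G[symmetric] g.expand)
  have X: "\<phi> X = 1" using nz by (simp add: X_def \<phi>)
  define \<alpha> where "\<alpha> = h G X"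
  have 1: "h G Y = 0" if "\<phi> Y = 0" for Y
    using star[of X Y G] that X by (simp add: G g.sym[of _ G] h.sym[of Y G])
  have 2: "h Y Z = \<alpha> * g Y Z" if "\<phi> Y = 0" for Y Z
    using star[of X Y Z] that X 1[OF that] by (simp add: \<alpha>_def)
  have 3: "h G Z = \<alpha> * \<phi> Z" for Z
    using 1[of "Z - \<phi> Z *\<^sub>R X"] X by (simp add: \<phi> h.expand \<alpha>_def)
  have 4: "h x y = \<alpha> * g x y" if nz: "\<phi> G \<noteq> 0" for x y
  proof -
    define x' where "x' = x - (\<phi> x / \<phi> G) *\<^sub>R G"
    have x: "x = x' + (\<phi> x / \<phi> G) *\<^sub>R G" by (simp add: x'_def)
    have "\<phi> x' = 0" using nz by (simp add: x'_def \<phi>)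
    then have "h (x' + (\<phi> x / \<phi> G) *\<^sub>R G) y = \<alpha> * g (x' + (\<phi> x / \<phi> G) *\<^sub>R G) y"
      by (simp add: h.expand g.expand 2 3 G algebra_simps)
    then show ?thesis using x by simp
  qed
  show thesis using that 2 3 4 by blast
qed

section \<open>Parametrized hypersurfaces\<close>

lemma bounded_bilinear_pmetric: "bounded_bilinear (pmetric S)"
proof -
  have "linear (\<lambda>x. pmetric S x y)" "linear (\<lambda>y. pmetric S x y)" for x y
    by (rule linearI; simp add: pmetric_def algebra_simps sum.distrib sum_distrib_left)+
  then show ?thesis
    by (simp add: bilinear_conv_bounded_bilinear[symmetric] bilinear_def)
qed

lemma pmetric_sym: "pmetric S x y = pmetric S y x"
  by (simp add: pmetric_def mult.commute)

lemma pmetric_nondegenerate: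
  assumes "\<And>y. pmetric S x y = 0"
  shows "x = 0"
proof (rule vec_eq_iff[THEN iffD2], rule allI)
  fix i
  have "(if i \<in> S then -1 else 1) * (x $ i) = 0"
    using assms[of "axis i 1"] by (simp add: pmetric_def axis_def if_distrib[of "(*) _"] cong: if_cong)
  then show "x $ i = 0 $ i" by (auto split: if_splits)
qed

lemmas pmetric_simps =
  bounded_bilinear.add_left[OF bounded_bilinear_pmetric]
  bounded_bilinear.add_right[OF bounded_bilinear_pmetric]
  bounded_bilinear.diff_left[OF bounded_bilinear_pmetric]
  bounded_bilinear.diff_right[OF bounded_bilinear_pmetric]
  bounded_bilinear.minus_left[OF bounded_bilinear_pmetric]
  bounded_bilinear.minus_right[OF bounded_bilinear_pmetric]
  bounded_bilinear.scaleR_left[OF bounded_bilinear_pmetric]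
  bounded_bilinear.scaleR_right[OF bounded_bilinear_pmetric]
  bounded_bilinear.zero_left[OF bounded_bilinear_pmetric]
  bounded_bilinear.zero_right[OF bounded_bilinear_pmetric]

lemma dir_pmetric:
  assumes "f differentiable (at u)" "g differentiable (at u)"
  shows "dir a (\<lambda>x. pmetric S (f x) (g x)) u = pmetric S (f u) (dir a g u) + pmetric S (dir a f u) (g u)"
  by (rule dir_bilinear[OF bounded_bilinear_pmetric assms])

text \<open>\<open>nondeg\<close> concludes \<open>a = 0\<close> and not merely
  \<open>dir a X u = 0\<close>, so it includes that \<open>X\<close> is an immersion.\<close>

locale patch =
  fixes S :: "'N::finite set" and U :: "(real ^ 'n::finite) set"
    and X n :: "real ^ 'n \<Rightarrow> real ^ 'N" and \<epsilon> :: real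
  assumes card: "CARD('N) = CARD('n) + 1"
    and smooth_X: "C_inf_on U X" and smooth_n: "C_inf_on U n"
    and eps: "\<epsilon> \<in> {1, -1}"
    and normal: "u \<in> U \<Longrightarrow> pmetric S (n u) (dir a X u) = 0"
    and unit: "u \<in> U \<Longrightarrow> pmetric S (n u) (n u) = \<epsilon>"
    and nondeg: "u \<in> U \<Longrightarrow> (\<And>b. pmetric S (dir a X u) (dir b X u) = 0) \<Longrightarrow> a = 0"
begin

definition I1 :: "real ^ 'n \<Rightarrow> real ^ 'n \<Rightarrow> real ^ 'n \<Rightarrow> real" where
  "I1 u a b = pmetric S (dir a X u) (dir b X u)"

text \<open>As \<epsilon> is 1 or -1, the factor \<epsilon> stands for the division by
  \<open>pmetric S (n u) (n u)\<close>.\<close>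

definition I2 :: "real ^ 'n \<Rightarrow> real ^ 'n \<Rightarrow> real ^ 'n \<Rightarrow> real" where
  "I2 u a b = - \<epsilon> * pmetric S (dir a n u) (dir b X u)"

text \<open>Raising an index: the vector that represents the linear form \<phi> with respect to
  \<open>I1\<close>. The inverse matrix gives smooth dependence on \<open>u\<close> and matches
  \<open>christoffel\<close>.\<close>

definition sharp :: "real ^ 'n \<Rightarrow> (real ^ 'n \<Rightarrow> real) \<Rightarrow> real ^ 'n" where
  "sharp u \<phi> = matrix_inv (induced_metric S X u) *v (\<chi> l. \<phi> (axis l 1))"

text \<open>\<open>coord u v\<close> are the coordinates of the tangential part of \<open>v\<close>. Directions in the parameter domain
  serve as tangent vectors, which keeps the formulas free of indices: \<open>Gam u a b\<close> is
  \<open>\<Sum>\<^sub>k \<Gamma>\<^sup>k\<^sub>i\<^sub>j a\<^sup>i b\<^sup>j \<partial>\<^sub>k\<close>, and \<open>shape\<close> is the operator \<open>A\<close> with \<open>I1 (A a) b = I2 a b\<close>.\<close>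

definition coord :: "real ^ 'n \<Rightarrow> real ^ 'N \<Rightarrow> real ^ 'n" where
  "coord u v = sharp u (\<lambda>b. pmetric S v (dir b X u))"

definition Gam :: "real ^ 'n \<Rightarrow> real ^ 'n \<Rightarrow> real ^ 'n \<Rightarrow> real ^ 'n" where
  "Gam u a b = coord u (dir a (dir b X) u)"

definition shape :: "real ^ 'n \<Rightarrow> real ^ 'n \<Rightarrow> real ^ 'n" where
  "shape u a = - \<epsilon> *\<^sub>R coord u (dir a n u)"

lemma open_U: "open U" using smooth_X C_inf_on_open by blast

lemma dX_add: "u \<in> U \<Longrightarrow> dir (a + b) X u = dir a X u + dir b X u"
  and dX_scale: "u \<in> U \<Longrightarrow> dir (r *\<^sub>R a) X u = r *\<^sub>R dir a X u"
  and dX_diff: "u \<in> U \<Longrightarrow> dir (a - b) X u = dir a X u - dir b X u"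
  and dX_minus: "u \<in> U \<Longrightarrow> dir (- a) X u = - dir a X u"
  and dX_zero: "u \<in> U \<Longrightarrow> dir 0 X u = 0"
  using linear_add[OF dir_linear_arg[OF smooth_X]] linear_scale[OF dir_linear_arg[OF smooth_X]]
    linear_diff[OF dir_linear_arg[OF smooth_X]] linear_neg[OF dir_linear_arg[OF smooth_X]]
    linear_0[OF dir_linear_arg[OF smooth_X]] by blast+

lemmas dX = dX_add dX_scale dX_diff dX_minus dX_zero

lemma I1_sym: "I1 u a b = I1 u b a"
  by (simp add: I1_def pmetric_sym)

lemma I1_linear_left: "u \<in> U \<Longrightarrow> linear (\<lambda>a. I1 u a b)"
  and I1_linear_right: "u \<in> U \<Longrightarrow> linear (\<lambda>b. I1 u a b)"
  by (rule linearI; simp add: I1_def dX pmetric_simps)+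

lemma I1_simps:
  assumes "u \<in> U"
  shows "I1 u (a + b) c = I1 u a c + I1 u b c" "I1 u c (a + b) = I1 u c a + I1 u c b"
    "I1 u (a - b) c = I1 u a c - I1 u b c" "I1 u c (a - b) = I1 u c a - I1 u c b"
    "I1 u (r *\<^sub>R a) c = r * I1 u a c" "I1 u c (r *\<^sub>R a) = r * I1 u c a"
    "I1 u (- a) c = - I1 u a c" "I1 u c (- a) = - I1 u c a"
    "I1 u 0 c = 0" "I1 u c 0 = 0"
  by (simp_all add: I1_def dX[OF assms] pmetric_simps)

lemma I1_eqI:
  assumes "u \<in> U" "\<And>b. I1 u a b = I1 u a' b"
  shows "a = a'"
proof -
  have "pmetric S (dir (a - a') X u) (dir b X u) = 0" for b
    using assms by (simp add: I1_def dX pmetric_simps)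
  then show ?thesis using nondeg[OF assms(1), of "a - a'"] by simp
qed

lemma induced_metric_mult:
  assumes "u \<in> U"
  shows "(induced_metric S X u *v a) $ l = I1 u a (axis l 1)"
proof -
  have "I1 u a (axis l 1) = I1 u (\<Sum>j\<in>UNIV. a $ j *s axis j 1) (axis l 1)"
    by (simp add: basis_expansion)
  also have "\<dots> = (\<Sum>j\<in>UNIV. a $ j * I1 u (axis j 1) (axis l 1))"
    using I1_linear_left[OF assms] 
    by (simp add: linear_sum[of "\<lambda>a. I1 u a (axis l 1)"] linear_scale[of "\<lambda>a. I1 u a (axis l 1)"] scalar_mult_eq_scaleR)
  also have "\<dots> = (induced_metric S X u *v a) $ l"
    by (simp add: matrix_vector_mult_def induced_metric_def I1_def dir_def pmetric_sym mult.commute)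
  finally show ?thesis by simp
qed

lemma invertible_induced_metric:
  assumes "u \<in> U"
  shows "invertible (induced_metric S X u)"
proof -
  have "a = 0" if "induced_metric S X u *v a = 0" for a
  proof (rule I1_eqI[OF assms])
    fix b :: "real ^ 'n"
    have *: "I1 u a (axis l 1) = 0" for l
      using induced_metric_mult[OF assms, of a l] that by simp
    have "I1 u a b = I1 u a (\<Sum>j\<in>UNIV. b $ j *s axis j 1)"
      by (simp add: basis_expansion)
    also have "\<dots> = 0"
      using I1_linear_right[OF assms] *
      by (simp add: linear_sum[of "\<lambda>b. I1 u a b"] linear_scale[of "\<lambda>b. I1 u a b"] scalar_mult_eq_scaleR)
    finally show "I1 u a b = I1 u 0 b" 
      using linear_0[OF I1_linear_left[OF assms]] by simp
  qed
  then show ?thesis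
    using matrix_left_invertible_ker invertible_left_inverse by blast
qed

lemma I1_sharp:
  assumes "u \<in> U" and l2: "linear \<phi>"
  shows "I1 u (sharp u \<phi>) b = \<phi> b"
proof -
  have *: "I1 u (sharp u \<phi>) (axis l 1) = \<phi> (axis l 1)" for l
  proof -
    have "induced_metric S X u *v sharp u \<phi> = (\<chi> l. \<phi> (axis l 1))"
      by (simp add: sharp_def matrix_vector_mul_assoc matrix_mul_matrix_inv invertible_induced_metric assms)
    then show ?thesis using induced_metric_mult[OF assms(1), of "sharp u \<phi>" l] by simp
  qed
  have "(\<lambda>b. I1 u (sharp u \<phi>) b) = \<phi>"
  proof (rule linear_eq_stdbasis[OF I1_linear_right[OF assms(1)] l2])
    fix b :: "real ^ 'n" assume "b \<in> Basis"
    then obtain l where "b = axis l 1" by (auto simp: Basis_vec_def)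
    then show "I1 u (sharp u \<phi>) b = \<phi> b" using * by simp
  qed
  then show ?thesis by metis
qed

lemma I1_coord:
  assumes "u \<in> U"
  shows "I1 u (coord u v) b = pmetric S v (dir b X u)"
  unfolding coord_def
  by (rule I1_sharp[OF assms], rule linearI) (simp_all add: dX assms pmetric_simps)

lemma coord_dir: "u \<in> U \<Longrightarrow> coord u (dir a X u) = a"
  by (rule I1_eqI[of u]) (simp_all add: I1_coord, simp add: I1_def)

lemma coord_normal: "u \<in> U \<Longrightarrow> coord u (n u) = 0"
  by (rule I1_eqI[of u]) (simp_all add: I1_coord I1_simps normal)

lemma coord_linear: "u \<in> U \<Longrightarrow> linear (coord u)"
  by (rule linearI; rule I1_eqI[of u])
    (simp_all add: I1_coord pmetric_simps I1_simps)

lemma frame_unique: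
  assumes "u \<in> U" "dir a X u + s *\<^sub>R n u = dir b X u + t *\<^sub>R n u"
  shows "a = b" "s = t"
proof -
  have "coord u (dir a X u + s *\<^sub>R n u) = coord u (dir b X u + t *\<^sub>R n u)"
    using assms by simp
  then show "a = b"
    by (simp add: linear_add[OF coord_linear] linear_scale[OF coord_linear] coord_dir coord_normal assms(1))
  have "pmetric S (n u) (dir a X u + s *\<^sub>R n u) = pmetric S (n u) (dir b X u + t *\<^sub>R n u)"
    using assms by simp
  then show "s = t"
    using eps by (auto simp add: pmetric_simps normal unit assms(1))
qed

text \<open>By \<open>card\<close> the injective map from components to ambient vectors acts between
  spaces of equal dimension, so tangent directions and normal span everything. The remainder
  \<open>w\<close> is orthogonal to all of them, hence zero.\<close>

lemma frame_expansion:
  assumes "u \<in> U"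
  shows "v = dir (coord u v) X u + (\<epsilon> * pmetric S v (n u)) *\<^sub>R n u"
proof -
  define L where "L = (\<lambda>(a :: real ^ 'n, t :: real). dir a X u + t *\<^sub>R n u)"
  have L: "linear L"
    by (rule linearI) (auto simp: L_def dX assms algebra_simps)
  have "inj L"
    using frame_unique[OF assms] by (auto simp: inj_def L_def)
  moreover have "DIM(real ^ 'N) = DIM((real ^ 'n) \<times> real)"
    by (simp add: card)
  moreover have "span (range L) = range L"
    using linear_subspace_image[OF L subspace_UNIV] by (subst span_eq_iff)
  ultimately have "span (range L) = UNIV"
    using dim_image_eq[OF L, of UNIV] dim_eq_full[of "range L"] by (simp add: inj_on_subset)
  with \<open>span (range L) = range L\<close> have surj: "surj L" by metis
  define w where "w = v - (dir (coord u v) X u + (\<epsilon> * pmetric S v (n u)) *\<^sub>R n u)"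
  have w1: "pmetric S w (dir b X u) = 0" for b
    using I1_coord[OF assms, of v b] normal[OF assms]
    by (simp add: w_def pmetric_simps I1_def)
  have w2: "pmetric S w (n u) = 0"
    using normal[OF assms] eps
    by (auto simp add: w_def pmetric_simps unit[OF assms] pmetric_sym[of S "dir _ X u"])
  have "pmetric S w y = 0" for y
  proof -
    obtain a t where "y = L (a, t)" using surj by (metis surj_def prod.exhaust)
    then show ?thesis by (simp add: L_def pmetric_simps w1 w2)
  qed
  then have "w = 0" by (rule pmetric_nondegenerate)
  then show ?thesis by (simp add: w_def)
qed

lemma smooth_I1: "C_inf_on U (\<lambda>u. I1 u a b)"
  unfolding I1_def by (intro C_inf_on_bilinear[OF bounded_bilinear_pmetric] C_inf_on_dir smooth_X)

lemma smooth_I2: "C_inf_on U (\<lambda>u. I2 u a b)"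
  unfolding I2_def
  by (intro C_inf_on_mult C_inf_on_const open_U C_inf_on_bilinear[OF bounded_bilinear_pmetric]
      C_inf_on_dir smooth_X smooth_n)

lemma smooth_sharp:
  assumes "\<And>b. C_inf_on U (\<lambda>u. \<phi> u b)"
  shows "C_inf_on U (\<lambda>u. sharp u (\<phi> u))"
proof -
  have im: "C_inf_on U (\<lambda>u. induced_metric S X u $ i $ j)" for i j
    using smooth_I1[of "axis i 1" "axis j 1"] by (simp add: induced_metric_def I1_def dir_def)
  have "C_inf_on U (\<lambda>u. \<chi> k. \<Sum>l\<in>UNIV. matrix_inv (induced_metric S X u) $ k $ l * \<phi> u (axis l 1))"
    by (intro C_inf_on_vec_lambda C_inf_on_sum C_inf_on_mult C_inf_on_matrix_inv open_U im
        invertible_induced_metric assms)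
  then show ?thesis
    by (simp add: sharp_def matrix_vector_mult_def)
qed

lemma smooth_coord:
  assumes "C_inf_on U v"
  shows "C_inf_on U (\<lambda>u. coord u (v u))"
  unfolding coord_def
  by (intro smooth_sharp C_inf_on_bilinear[OF bounded_bilinear_pmetric] assms C_inf_on_dir smooth_X)

lemma smooth_Gam: "C_inf_on U (\<lambda>u. Gam u a b)"
  unfolding Gam_def by (intro smooth_coord C_inf_on_dir smooth_X)

section \<open>The formulas of Gauss and Weingarten and the structure equations\<close>

lemmas differentiable_X = C_inf_on_differentiable[OF smooth_X]
lemmas differentiable_dX = C_inf_on_differentiable[OF C_inf_on_dir[OF smooth_X]]
lemmas differentiable_n = C_inf_on_differentiable[OF smooth_n]

lemma dir_const_on:
  assumes "\<And>x. x \<in> U \<Longrightarrow> F x = c" "u \<in> U"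
  shows "dir a F u = 0"
  using dir_transform(2)[OF open_U assms(2), of "\<lambda>x. c" F a] assms(1) by (simp add: dir_def)

text \<open>Differentiating the orthogonality of \<open>n\<close> and \<open>dir b X\<close> moves
  the derivative from the normal to the tangent vector. Symmetry of \<open>I2\<close> then follows
  from that of second derivatives.\<close>

lemma I2_hess:
  assumes "u \<in> U"
  shows "I2 u a b = \<epsilon> * pmetric S (dir a (dir b X) u) (n u)"
proof -
  have "dir a (\<lambda>x. pmetric S (n x) (dir b X x)) u = 0"
    by (rule dir_const_on[OF normal assms])
  then have "pmetric S (dir a n u) (dir b X u) = - pmetric S (n u) (dir a (dir b X) u)"
    using dir_pmetric[OF differentiable_n[OF assms] differentiable_dX[OF assms, of b], of a S] by linarith
  then show ?thesis by (simp add: I2_def pmetric_sym[of S "n u"])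
qed

lemma I2_sym: "u \<in> U \<Longrightarrow> I2 u a b = I2 u b a"
  using dir_symmetric[OF smooth_X] by (simp add: I2_hess)

lemma I2_linear_right: "u \<in> U \<Longrightarrow> linear (\<lambda>b. I2 u a b)"
  by (rule linearI) (simp_all add: I2_def dX pmetric_simps algebra_simps)

lemma I2_linear_left: "u \<in> U \<Longrightarrow> linear (\<lambda>a. I2 u a b)"
  using I2_linear_right[of u b] I2_sym[of u b] by simp

lemma Gam_sym: "u \<in> U \<Longrightarrow> Gam u a b = Gam u b a"
  using dir_symmetric[OF smooth_X] by (simp add: Gam_def)

lemma gauss_formula:
  assumes "u \<in> U"
  shows "dir a (dir b X) u = dir (Gam u a b) X u + I2 u a b *\<^sub>R n u"
  using frame_expansion[OF assms, of "dir a (dir b X) u"] by (simp add: Gam_def I2_hess assms)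

lemma weingarten:
  assumes "u \<in> U"
  shows "dir a n u = - \<epsilon> *\<^sub>R dir (shape u a) X u"
proof -
  have "dir a (\<lambda>x. pmetric S (n x) (n x)) u = 0"
    by (rule dir_const_on[OF unit assms])
  then have "pmetric S (dir a n u) (n u) = 0"
    using dir_pmetric[OF differentiable_n[OF assms] differentiable_n[OF assms], of a S]
    by (simp add: pmetric_sym[of S "n u"])
  moreover have "coord u (dir a n u) = - \<epsilon> *\<^sub>R shape u a"
    using eps by (auto simp: shape_def)
  ultimately show ?thesis
    using frame_expansion[OF assms, of "dir a n u"] by (simp add: dX assms)
qed

lemma I1_shape: "u \<in> U \<Longrightarrow> I1 u (shape u a) b = I2 u a b"
  by (simp add: shape_def I1_simps I1_coord I2_def)

text \<open>The derivative of a vector field along the hypersurface in terms of its tangential component \<open>w\<close> and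
  its normal component \<open>s\<close>. The components depend only on the two fundamental forms; this yields the
  Gauss and Codazzi equations and the rigidity.\<close>

lemma dir_frame:
  assumes u: "u \<in> U" and w: "w differentiable (at u)" and s: "s differentiable (at u)"
  shows "dir c (\<lambda>x. dir (w x) X x + s x *\<^sub>R n x) u =
    dir (dir c w u + Gam u c (w u) - (\<epsilon> * s u) *\<^sub>R shape u c) X u
    + (dir c s u + I2 u c (w u)) *\<^sub>R n u"
proof -
  have sn: "(\<lambda>x. s x *\<^sub>R n x) differentiable (at u)"
    using differentiable_bilinear[OF bounded_bilinear_scaleR s differentiable_n[OF u]] .
  have "dir c (\<lambda>x. dir (w x) X x + s x *\<^sub>R n x) u =
    (dir (dir c w u) X u + dir c (dir (w u) X) u) + (s u *\<^sub>R dir c n u + dir c s u *\<^sub>R n u)"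
    using dir_plus[OF dir_along(2)[OF smooth_X u w] sn] dir_along(1)[OF smooth_X u w]
      dir_bilinear[OF bounded_bilinear_scaleR s differentiable_n[OF u]] by simp
  then show ?thesis
    by (simp add: gauss_formula weingarten u dX algebra_simps)
qed

lemma dir_frame_diff:
  assumes u: "u \<in> U" and w: "w differentiable (at u)" and s: "s differentiable (at u)"
  shows "(\<lambda>x. dir (w x) X x + s x *\<^sub>R n x) differentiable (at u)"
  using dir_along(2)[OF smooth_X u w] differentiable_bilinear[OF bounded_bilinear_scaleR s differentiable_n[OF u]]
  by simp

lemmas differentiable_Gam = C_inf_on_differentiable[OF smooth_Gam]
lemmas differentiable_I1 = C_inf_on_differentiable[OF smooth_I1]
lemmas differentiable_I2 = C_inf_on_differentiable[OF smooth_I2]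

text \<open>The left side is symmetric in \<open>c\<close> and \<open>a\<close>; equating tangential
  parts gives the Gauss equation, equating normal parts the Codazzi equation.\<close>

lemma third_derivative:
  assumes u: "u \<in> U"
  shows "dir c (dir a (dir b X)) u =
    dir (dir c (\<lambda>x. Gam x a b) u + Gam u c (Gam u a b) - (\<epsilon> * I2 u a b) *\<^sub>R shape u c) X u
    + (dir c (\<lambda>x. I2 x a b) u + I2 u c (Gam u a b)) *\<^sub>R n u"
proof -
  have "dir c (dir a (dir b X)) u = dir c (\<lambda>x. dir (Gam x a b) X x + I2 x a b *\<^sub>R n x) u"
    using dir_transform(2)[OF open_U u, of "\<lambda>x. dir (Gam x a b) X x + I2 x a b *\<^sub>R n x" "dir a (dir b X)" c]
      dir_frame_diff[OF u differentiable_Gam[OF u] differentiable_I2[OF u], of a b a b] gauss_formula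
    by simp
  then show ?thesis
    using dir_frame[OF u differentiable_Gam[OF u] differentiable_I2[OF u], of c a b a b] by simp
qed

text \<open>Constant directions have vanishing bracket, so the left side is the vector
  \<open>R(c,a)b\<close>.\<close>

lemma gauss_equation:
  assumes u: "u \<in> U"
  shows "dir c (\<lambda>x. Gam x a b) u - dir a (\<lambda>x. Gam x c b) u + Gam u c (Gam u a b) - Gam u a (Gam u c b)
    = \<epsilon> *\<^sub>R (I2 u a b *\<^sub>R shape u c - I2 u c b *\<^sub>R shape u a)"
  using frame_unique(1)[OF u trans[OF trans[OF third_derivative[OF u, symmetric]
      dir_symmetric[OF C_inf_on_dir[OF smooth_X] u]] third_derivative[OF u]], of c a b]
  by (simp add: algebra_simps)

lemma codazzi_equation:
  assumes u: "u \<in> U"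
  shows "dir c (\<lambda>x. I2 x a b) u - dir a (\<lambda>x. I2 x c b) u = I2 u a (Gam u c b) - I2 u c (Gam u a b)"
  using frame_unique(2)[OF u trans[OF trans[OF third_derivative[OF u, symmetric]
      dir_symmetric[OF C_inf_on_dir[OF smooth_X] u]] third_derivative[OF u]], of c a b]
  by (simp add: algebra_simps)

text \<open>Metric compatibility: \<open>dir c w u + Gam u c (w u)\<close> is the covariant
  derivative of \<open>w\<close>, and the normal part of the flat derivative drops out of products
  with tangent vectors.\<close>

lemma dir_I1:
  assumes u: "u \<in> U" and w: "w differentiable (at u)" and z: "z differentiable (at u)"
  shows "dir c (\<lambda>x. I1 x (w x) (z x)) u =
    I1 u (dir c w u + Gam u c (w u)) (z u) + I1 u (w u) (dir c z u + Gam u c (z u))"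
proof -
  have *: "dir c (\<lambda>x. dir (w x) X x) u = dir (dir c w u + Gam u c (w u)) X u + I2 u c (w u) *\<^sub>R n u"
    if "w differentiable (at u)" for w
    using dir_along(1)[OF smooth_X u that, of c] by (simp add: gauss_formula u dX)
  show ?thesis
    using dir_pmetric[OF dir_along(2)[OF smooth_X u w] dir_along(2)[OF smooth_X u z], of c S]
    by (simp add: I1_def *[OF w] *[OF z] pmetric_simps normal u pmetric_sym[of S "dir _ X u" "n u"])
qed

lemma Gam_linear_right: "u \<in> U \<Longrightarrow> linear (\<lambda>b. Gam u a b)"
proof -
  assume u: "u \<in> U"
  have "Gam u b a = Gam u a b" for b using Gam_sym[OF u] .
  moreover have "linear (\<lambda>b. Gam u b a)"
    unfolding Gam_def
    using linear_compose[OF dir_linear_arg[OF C_inf_on_dir[OF smooth_X] u] coord_linear[OF u]]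
    by (simp add: comp_def)
  ultimately show ?thesis by simp
qed

text \<open>The right side depends on the metric alone. This both identifies \<open>Gam\<close> with
  the Christoffel symbols and determines its change under a conformal factor.\<close>

lemma koszul:
  assumes u: "u \<in> U"
  shows "2 * I1 u (Gam u a b) c =
    dir a (\<lambda>x. I1 x b c) u + dir b (\<lambda>x. I1 x a c) u - dir c (\<lambda>x. I1 x a b) u"
  using dir_I1[OF u, of "\<lambda>_. b" "\<lambda>_. c" a] dir_I1[OF u, of "\<lambda>_. a" "\<lambda>_. c" b]
    dir_I1[OF u, of "\<lambda>_. a" "\<lambda>_. b" c]
  by (simp add: dir_const Gam_sym[OF u, of b a] Gam_sym[OF u, of c] I1_sym[of u _ "Gam u _ _"])

lemma sym_form_I1: "u \<in> U \<Longrightarrow> sym_form (I1 u)"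
  by (rule sym_form.intro)
    (simp_all add: I1_sym I1_linear_left I1_linear_right bilinear_conv_bounded_bilinear[symmetric] bilinear_def)

lemma sym_form_I2: "u \<in> U \<Longrightarrow> sym_form (I2 u)"
  by (rule sym_form.intro)
    (simp_all add: I2_sym I2_linear_left I2_linear_right bilinear_conv_bounded_bilinear[symmetric] bilinear_def)

lemma pseudo_scalar_product_I1: "u \<in> U \<Longrightarrow> pseudo_scalar_product (I1 u)"
  using nondeg unfolding I1_def[symmetric]
  by (intro pseudo_scalar_product.intro sym_form_I1 pseudo_scalar_product_axioms.intro) auto

lemma I2_simps:
  assumes "u \<in> U"
  shows "I2 u (a + b) c = I2 u a c + I2 u b c" "I2 u c (a + b) = I2 u c a + I2 u c b"
    "I2 u (a - b) c = I2 u a c - I2 u b c" "I2 u c (a - b) = I2 u c a - I2 u c b"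
    "I2 u (r *\<^sub>R a) c = r * I2 u a c" "I2 u c (r *\<^sub>R a) = r * I2 u c a"
proof -
  interpret sym_form "I2 u" by (rule sym_form_I2[OF assms])
  show "I2 u (a + b) c = I2 u a c + I2 u b c" "I2 u c (a + b) = I2 u c a + I2 u c b"
    "I2 u (a - b) c = I2 u a c - I2 u b c" "I2 u c (a - b) = I2 u c a - I2 u c b"
    "I2 u (r *\<^sub>R a) c = r * I2 u a c" "I2 u c (r *\<^sub>R a) = r * I2 u c a"
    by (simp_all add: expand)
qed

end

section \<open>Hypersurfaces with proportional fundamental forms\<close>

lemma zero_on_dense:
  fixes f :: "'a::metric_space \<Rightarrow> real"
  assumes "open U" "continuous_on U f" "U \<subseteq> closure D" "\<And>x. x \<in> D \<Longrightarrow> x \<in> U \<Longrightarrow> f x = 0" "u \<in> U"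
  shows "f u = 0"
proof (rule ccontr)
  assume nz: "f u \<noteq> 0"
  have "open {x \<in> U. f x \<in> - {0}}"
    using continuous_open_preimage[OF assms(2,1) open_Compl[OF closed_singleton[of 0]]]
    by (simp add: vimage_def Int_def)
  moreover have "u \<in> {x \<in> U. f x \<in> - {0}}" using nz assms(5) by auto
  moreover have "u \<in> closure D" using assms by auto
  ultimately have "D \<inter> {x \<in> U. f x \<in> - {0}} \<noteq> {}"
    using open_Int_closure_eq_empty[of "{x \<in> U. f x \<in> - {0}}" D] by blast
  then show False using assms(4) by auto
qed

text \<open>Both hypersurfaces share one parameter domain, \<open>Y\<close> being meant as
  \<open>f\<close> after the chart \<open>X\<close>; on directions in the domain the differential of
  \<open>f\<close> is then the identity.\<close>

locale patch_pair = X: patch S U X n \<epsilon> + Y: patch S U Y m \<epsilon>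
  for S :: "'N::finite set" and U :: "(real ^ 'n::finite) set"
    and X n Y m :: "real ^ 'n \<Rightarrow> real ^ 'N" and \<epsilon> :: real +
  fixes L :: "real ^ 'n \<Rightarrow> real"
  assumes smooth_L: "C_inf_on U L"
    and I1_bar: "u \<in> U \<Longrightarrow> Y.I1 u a b = L u * X.I1 u a b"
    and I2_bar: "u \<in> U \<Longrightarrow> Y.I2 u a b = L u * X.I2 u a b"
begin

lemma L_nonzero:
  assumes "u \<in> U"
  shows "L u \<noteq> 0"
proof
  assume "L u = 0"
  then have "axis k 1 = (0 :: real ^ 'n)" for k
    using Y.I1_eqI[OF assms, of "axis k 1" 0] I1_bar[OF assms] by simp
  then show False by (simp add: axis_eq_0_iff)
qed

text \<open>With \<open>L = \<plusminus>exp (2\<phi>)\<close>, \<open>phi\<close> is \<open>d\<phi>\<close>.\<close>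

definition phi :: "real ^ 'n \<Rightarrow> real ^ 'n \<Rightarrow> real" where
  "phi u a = dir a L u / (2 * L u)"

definition grad :: "real ^ 'n \<Rightarrow> real ^ 'n" where
  "grad u = X.sharp u (phi u)"

lemma smooth_phi: "C_inf_on U (\<lambda>u. phi u a)"
  unfolding phi_def
  by (intro C_inf_on_divide C_inf_on_dir smooth_L C_inf_on_mult C_inf_on_const X.open_U)
    (simp add: L_nonzero)

lemma phi_linear:
  assumes "u \<in> U"
  shows "linear (phi u)"
proof -
  note lin = dir_linear_arg[OF smooth_L assms]
  show ?thesis
    by (rule linearI)
      (simp_all add: phi_def linear_add[OF lin] linear_scale[OF lin] add_divide_distrib)
qed

lemma dir_L: "u \<in> U \<Longrightarrow> dir a L u = 2 * L u * phi u a"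
  by (simp add: phi_def L_nonzero)

text \<open>\<open>phi\<close> is closed: the only part of the second derivative of \<open>L\<close>
  that is not visibly symmetric is the derivative of \<open>phi\<close>.\<close>

lemma phi_sym:
  assumes u: "u \<in> U"
  shows "dir a (\<lambda>x. phi x b) u = dir b (\<lambda>x. phi x a) u"
proof -
  have "dir a (dir b L) u = 2 * L u * dir a (\<lambda>x. phi x b) u + 4 * L u * phi u a * phi u b" for a b
  proof -
    have "dir a (dir b L) u = dir a (\<lambda>x. (2 * L x) * phi x b) u"
      by (rule dir_cong[OF X.open_U u]) (simp add: dir_L)
    also have "\<dots> = 2 * L u * dir a (\<lambda>x. phi x b) u + dir a (\<lambda>x. 2 * L x) u * phi u b"
      by (intro dir_bilinear[OF bounded_bilinear_mult] C_inf_on_differentiable[OF _ u] C_inf_on_mult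
          C_inf_on_const X.open_U smooth_L smooth_phi)
    also have "dir a (\<lambda>x. 2 * L x) u = 2 * dir a L u"
      using dir_bounded_linear[OF bounded_linear_mult_right[of 2] C_inf_on_differentiable[OF smooth_L u]] .
    finally show ?thesis by (simp add: dir_L u)
  qed
  then have "2 * L u * dir a (\<lambda>x. phi x b) u = 2 * L u * dir b (\<lambda>x. phi x a) u"
    using dir_symmetric[OF smooth_L u, of a b] by (simp add: mult.commute)
  then show ?thesis using L_nonzero[OF u] by simp
qed

lemma I1_grad: "u \<in> U \<Longrightarrow> X.I1 u (grad u) a = phi u a"
  unfolding grad_def by (intro X.I1_sharp phi_linear)

lemma I1_grad': "u \<in> U \<Longrightarrow> X.I1 u a (grad u) = phi u a"
  using I1_grad X.I1_sym by simp

lemma smooth_grad: "C_inf_on U grad"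
  unfolding grad_def[abs_def] by (intro X.smooth_sharp smooth_phi)

text \<open>The classical conformal change of the Levi-Civita connection, by comparing two Koszul
  formulas; the 2 in the definition of \<open>phi\<close> cancels the one on the left of
  \<open>koszul\<close>.\<close>

lemma Gam_bar:
  assumes u: "u \<in> U"
  shows "Y.Gam u a b = X.Gam u a b + phi u a *\<^sub>R b + phi u b *\<^sub>R a - X.I1 u a b *\<^sub>R grad u"
proof (rule X.I1_eqI[OF u])
  fix c
  have d: "dir a (\<lambda>x. Y.I1 x b c) u = L u * dir a (\<lambda>x. X.I1 x b c) u + 2 * L u * phi u a * X.I1 u b c" for a b c
  proof -
    have "dir a (\<lambda>x. Y.I1 x b c) u = dir a (\<lambda>x. L x * X.I1 x b c) u"
      by (rule dir_cong[OF X.open_U u]) (simp add: I1_bar)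
    also have "\<dots> = L u * dir a (\<lambda>x. X.I1 x b c) u + dir a L u * X.I1 u b c"
      by (rule dir_bilinear[OF bounded_bilinear_mult C_inf_on_differentiable[OF smooth_L u] X.differentiable_I1[OF u]])
    finally show ?thesis by (simp add: dir_L u)
  qed
  have "L u * (2 * X.I1 u (Y.Gam u a b) c) = 
    L u * (2 * X.I1 u (X.Gam u a b) c + 2 * phi u a * X.I1 u b c + 2 * phi u b * X.I1 u a c - 2 * phi u c * X.I1 u a b)"
    using Y.koszul[OF u, of a b c] arg_cong[OF X.koszul[OF u, of a b c], of "(*) (L u)"]
    by (simp add: d I1_bar u algebra_simps)
  then have "2 * X.I1 u (Y.Gam u a b) c = 
    2 * X.I1 u (X.Gam u a b) c + 2 * phi u a * X.I1 u b c + 2 * phi u b * X.I1 u a c - 2 * phi u c * X.I1 u a b"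
    using L_nonzero[OF u] by simp
  then show "X.I1 u (Y.Gam u a b) c =
    X.I1 u (X.Gam u a b + phi u a *\<^sub>R b + phi u b *\<^sub>R a - X.I1 u a b *\<^sub>R grad u) c"
    by (simp add: X.I1_simps u I1_grad algebra_simps)
qed

lemma shape_bar:
  assumes u: "u \<in> U"
  shows "Y.shape u a = X.shape u a"
proof (rule X.I1_eqI[OF u])
  fix b
  have "L u * X.I1 u (Y.shape u a) b = L u * X.I1 u (X.shape u a) b"
    using Y.I1_shape[OF u, of a b] X.I1_shape[OF u, of a b] by (simp add: I1_bar I2_bar u)
  then show "X.I1 u (Y.shape u a) b = X.I1 u (X.shape u a) b"
    using L_nonzero[OF u] by simp
qed

text \<open>Subtracting \<open>L\<close> times the Codazzi equation of \<open>X\<close> from that of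
  \<open>Y\<close> removes the derivatives of \<open>I2\<close>. Of the two terms
  \<open>phi u c * X.I2 u a b\<close> coming from the derivative of \<open>L\<close>, the change of
  \<open>Gam\<close> absorbs one; its terms with \<open>phi u b\<close> cancel by symmetry.\<close>

lemma codazzi_difference:
  assumes u: "u \<in> U"
  shows "phi u c * X.I2 u a b - phi u a * X.I2 u c b
    + X.I1 u c b * X.I2 u (grad u) a - X.I1 u a b * X.I2 u (grad u) c = 0"
proof -
  have d: "dir c (\<lambda>x. Y.I2 x a b) u = L u * dir c (\<lambda>x. X.I2 x a b) u + 2 * L u * phi u c * X.I2 u a b" for a b c
  proof -
    have "dir c (\<lambda>x. Y.I2 x a b) u = dir c (\<lambda>x. L x * X.I2 x a b) u"
      by (rule dir_cong[OF X.open_U u]) (simp add: I2_bar)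
    also have "\<dots> = L u * dir c (\<lambda>x. X.I2 x a b) u + dir c L u * X.I2 u a b"
      by (rule dir_bilinear[OF bounded_bilinear_mult C_inf_on_differentiable[OF smooth_L u] X.differentiable_I2[OF u]])
    finally show ?thesis by (simp add: dir_L u)
  qed
  have "L u * (dir c (\<lambda>x. X.I2 x a b) u - dir a (\<lambda>x. X.I2 x c b) u)
      + L u * (2 * phi u c * X.I2 u a b - 2 * phi u a * X.I2 u c b)
    = L u * (X.I2 u a (Y.Gam u c b) - X.I2 u c (Y.Gam u a b))"
    using Y.codazzi_equation[OF u, of c a b] by (simp add: d I2_bar u algebra_simps)
  then have "L u * ((X.I2 u a (X.Gam u c b) - X.I2 u c (X.Gam u a b))
      + (2 * phi u c * X.I2 u a b - 2 * phi u a * X.I2 u c b))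
    = L u * (X.I2 u a (Y.Gam u c b) - X.I2 u c (Y.Gam u a b))"
    by (simp only: X.codazzi_equation[OF u] distrib_left)
  then have "(X.I2 u a (X.Gam u c b) - X.I2 u c (X.Gam u a b))
      + (2 * phi u c * X.I2 u a b - 2 * phi u a * X.I2 u c b)
    = X.I2 u a (Y.Gam u c b) - X.I2 u c (Y.Gam u a b)"
    using L_nonzero[OF u] by simp
  then show ?thesis
    by (simp add: Gam_bar u X.I2_simps X.I2_sym[OF u, of _ "grad u"] X.I2_sym[OF u, of c a])
qed

text \<open>The curvature of a conformally changed metric involves the Hessian of \<open>\<phi>\<close>. Contracting with the
  gradient removes it, because the Hessian of a function with null gradient annihilates that gradient.\<close>

lemma gauss_difference_null:
  assumes null: "\<And>x. x \<in> U \<Longrightarrow> phi x (grad x) = 0" and u: "u \<in> U"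
  defines "v \<equiv> grad u"
  shows "(L u - 1) *\<^sub>R (X.I2 u a v *\<^sub>R X.shape u v - X.I2 u v v *\<^sub>R X.shape u a) = 0"
proof -
  \<comment> \<open>The covariant derivative of the gradient, that is the Hessian of \<phi> as an
    operator; its symmetry is the closedness of \<open>phi\<close>.\<close>
  define H where "H c = dir c grad u + X.Gam u c v" for c
  note dg = C_inf_on_differentiable[OF smooth_grad u]
  have dphi: "dir c (\<lambda>x. phi x b) u = X.I1 u (H c) b + phi u (X.Gam u c b)" for b c
  proof -
    have "dir c (\<lambda>x. phi x b) u = dir c (\<lambda>x. X.I1 x (grad x) b) u"
      by (rule dir_cong[OF X.open_U u]) (simp add: I1_grad)
    then show ?thesis
      using X.dir_I1[OF u dg, of "\<lambda>_. b" c] by (simp add: dir_const H_def v_def I1_grad u)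
  qed
  have Hsym: "X.I1 u (H c) b = X.I1 u (H b) c" for b c
    using phi_sym[OF u, of c b] by (simp add: dphi X.Gam_sym[OF u, of b c])
  \<comment> \<open>Differentiates the vanishing square of the gradient, which is why
    \<open>null\<close> is assumed on all of \<open>U\<close> and not only at \<open>u\<close>. With
    \<open>Hsym\<close> it gives \<open>H v = 0\<close>.\<close>
  have HG: "X.I1 u (H c) v = 0" for c
  proof -
    have "dir c (\<lambda>x. X.I1 x (grad x) (grad x)) u = 0"
      by (rule X.dir_const_on[OF _ u]) (simp add: I1_grad null)
    then show ?thesis
      using X.dir_I1[OF u dg dg, of c] by (simp add: X.I1_sym[of u "grad u"] H_def v_def)
  qed
  have "H v = 0"
    by (rule X.I1_eqI[OF u]) (simp add: Hsym[of v] HG X.I1_simps u)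
  then have Gv: "dir v grad u = - X.Gam u v v"
    by (simp add: H_def eq_neg_iff_add_eq_0)
  have p0: "phi u v = 0" using null[OF u] by (simp add: v_def)
  have g0: "X.I1 u v b = phi u b" "X.I1 u b v = phi u b" for b
    by (simp_all add: v_def I1_grad I1_grad' u)
  have bar: "Y.Gam u b c = X.Gam u b c + phi u b *\<^sub>R c + phi u c *\<^sub>R b - X.I1 u b c *\<^sub>R v" for b c
    by (simp add: Gam_bar u v_def)
  have dbar: "dir c (\<lambda>x. Y.Gam x b e) u = dir c (\<lambda>x. X.Gam x b e) u
      + dir c (\<lambda>x. phi x b) u *\<^sub>R e + dir c (\<lambda>x. phi x e) u *\<^sub>R b
      - (dir c (\<lambda>x. X.I1 x b e) u *\<^sub>R v + X.I1 u b e *\<^sub>R dir c grad u)" for c b e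
  proof -
    have "((\<lambda>x. X.Gam x b e + phi x b *\<^sub>R e + phi x e *\<^sub>R b - X.I1 x b e *\<^sub>R grad x) has_derivative
      (\<lambda>c. dir c (\<lambda>x. X.Gam x b e) u + dir c (\<lambda>x. phi x b) u *\<^sub>R e + dir c (\<lambda>x. phi x e) u *\<^sub>R b
      - (X.I1 u b e *\<^sub>R dir c grad u + dir c (\<lambda>x. X.I1 x b e) u *\<^sub>R grad u))) (at u)"
      by (intro has_derivative_add has_derivative_diff has_derivative_scaleR has_derivative_scaleR_left
          has_derivative_dir dg X.differentiable_Gam[OF u] X.differentiable_I1[OF u]
          C_inf_on_differentiable[OF smooth_phi u])
    then have "((\<lambda>x. Y.Gam x b e) has_derivative
      (\<lambda>c. dir c (\<lambda>x. X.Gam x b e) u + dir c (\<lambda>x. phi x b) u *\<^sub>R e + dir c (\<lambda>x. phi x e) u *\<^sub>R b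
      - (X.I1 u b e *\<^sub>R dir c grad u + dir c (\<lambda>x. X.I1 x b e) u *\<^sub>R grad u))) (at u)"
      by (rule has_derivative_transform_within_open[OF _ X.open_U u]) (simp add: Gam_bar)
    then show ?thesis by (simp add: dir_eqI v_def)
  qed
  have dI1: "dir c (\<lambda>x. X.I1 x b e) u = X.I1 u (X.Gam u c b) e + X.I1 u b (X.Gam u c e)" for c b e
    using X.dir_I1[OF u, of "\<lambda>_. b" "\<lambda>_. e" c] by (simp add: dir_const)
  have pH: "phi u (H c) = 0" "phi u 0 = 0" for c
    using HG[of c] linear_0[OF phi_linear[OF u]] by (simp_all add: g0)
  have bav: "Y.Gam u a v = X.Gam u a v" and bvv: "Y.Gam u v v = X.Gam u v v"
    by (simp_all add: bar g0 p0)
  \<comment> \<open>Both sides are the curvature vector \<open>R(v,a)v\<close>. Terms with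
    \<open>phi u v\<close>, \<open>phi u (H c)\<close> or \<open>H v\<close> vanish, and the other
    correction terms cancel.\<close>
  have "dir v (\<lambda>x. Y.Gam x a v) u - dir a (\<lambda>x. Y.Gam x v v) u + Y.Gam u v (Y.Gam u a v) - Y.Gam u a (Y.Gam u v v)
    = dir v (\<lambda>x. X.Gam x a v) u - dir a (\<lambda>x. X.Gam x v v) u + X.Gam u v (X.Gam u a v) - X.Gam u a (X.Gam u v v)"
    unfolding bav bvv unfolding bar dbar dphi dI1 Gv
    by (rule X.I1_eqI[OF u], simp only: X.I1_simps[OF u])
      (simp add: g0 p0 pH \<open>H v = 0\<close> X.I1_simps u X.Gam_sym[OF u, of v a] algebra_simps)
  then have "\<epsilon> *\<^sub>R (Y.I2 u a v *\<^sub>R Y.shape u v - Y.I2 u v v *\<^sub>R Y.shape u a)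
    = \<epsilon> *\<^sub>R (X.I2 u a v *\<^sub>R X.shape u v - X.I2 u v v *\<^sub>R X.shape u a)"
    unfolding X.gauss_equation[OF u] Y.gauss_equation[OF u] .
  then have "Y.I2 u a v *\<^sub>R Y.shape u v - Y.I2 u v v *\<^sub>R Y.shape u a
    = X.I2 u a v *\<^sub>R X.shape u v - X.I2 u v v *\<^sub>R X.shape u a"
    using X.eps by auto
  then show ?thesis
    by (simp add: I2_bar shape_bar u algebra_simps)
qed

text \<open>\<open>curved\<close> provides a nonzero 2 by 2 minor, so \<open>I2\<close> has rank at
  least two everywhere. If \<open>phi\<close> were nonzero at a point, it would be so nearby,
  forcing \<open>L = 1\<close> on an open set and hence \<open>phi = 0\<close> there. So
  \<open>phi\<close> vanishes and the two connections agree.\<close>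

lemma conformal_factor_eq_1:
  assumes dense: "U \<subseteq> closure {u \<in> U. \<not> (\<exists>\<alpha>. \<forall>a b. X.I2 u a b = \<alpha> * X.I1 u a b)}"
    and curved: "\<And>u. u \<in> U \<Longrightarrow> \<exists>a b c d. X.I2 u b c * X.I2 u a d - X.I2 u a c * X.I2 u b d \<noteq> 0"
    and u: "u \<in> U"
  shows "L u = 1"
proof -
  have lin: "phi u (a + b) = phi u a + phi u b" "phi u (r *\<^sub>R a) = r * phi u a" "phi u (a - b) = phi u a - phi u b"
    if "u \<in> U" for u a b r
    using linear_add[OF phi_linear[OF that]] linear_scale[OF phi_linear[OF that]]
      linear_diff[OF phi_linear[OF that]] by auto
  have null: "phi u (grad u) = 0" if u: "u \<in> U" for u
  proof (rule zero_on_dense[OF X.open_U _ dense _ u])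
    show "continuous_on U (\<lambda>u. phi u (grad u))"
      unfolding phi_def
      by (intro C_inf_on_continuous C_inf_on_divide C_inf_on_dir_along smooth_L smooth_grad
          C_inf_on_mult C_inf_on_const X.open_U) (simp add: L_nonzero)
    fix x assume x: "x \<in> {u \<in> U. \<not> (\<exists>\<alpha>. \<forall>a b. X.I2 u a b = \<alpha> * X.I1 u a b)}" "x \<in> U"
    show "phi x (grad x) = 0"
    proof (rule ccontr)
      assume nz: "phi x (grad x) \<noteq> 0"
      obtain \<alpha> where "phi x (grad x) \<noteq> 0 \<Longrightarrow> \<forall>a b. X.I2 x a b = \<alpha> * X.I1 x a b"
        using codazzi_algebra[OF X.sym_form_I1[OF x(2)] X.sym_form_I2[OF x(2)] I1_grad[OF x(2)]
            codazzi_difference[OF x(2)] nz] by metis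
      then show False using x nz by blast
    qed
  qed
  have L1: "L u = 1" if u: "u \<in> U" and nz: "phi u e \<noteq> 0" for u e
  proof (rule ccontr)
    assume L: "L u \<noteq> 1"
    obtain \<alpha> where \<alpha>: "\<And>Y Z. phi u Y = 0 \<Longrightarrow> X.I2 u Y Z = \<alpha> * X.I1 u Y Z" "\<And>Z. X.I2 u (grad u) Z = \<alpha> * phi u Z"
      using codazzi_algebra[OF X.sym_form_I1[OF u] X.sym_form_I2[OF u] I1_grad[OF u]
            codazzi_difference[OF u] nz] by metis
    have "X.I2 u e (grad u) *\<^sub>R X.shape u (grad u) - X.I2 u (grad u) (grad u) *\<^sub>R X.shape u e = 0"
      using gauss_difference_null[OF null u, of e] L by simp
    then have "X.I2 u e (grad u) *\<^sub>R X.shape u (grad u) = 0"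
      using \<alpha>(2) null[OF u] by simp
    \<comment> \<open>Pairing with \<open>e\<close> turns the vector equation into the vanishing of
      the square of \<open>\<alpha> * phi u e\<close>.\<close>
    then have "X.I1 u (X.I2 u e (grad u) *\<^sub>R X.shape u (grad u)) e = 0"
      using X.I1_simps(9)[OF u] by metis
    then have "\<alpha> = 0"
      using nz by (simp add: X.I1_simps u X.I1_shape \<alpha> X.I2_sym[OF u, of e "grad u"])
    then have ker: "X.I2 u Y Z = 0" if "phi u Y = 0" for Y Z
      using \<alpha>(1)[OF that] by simp
    \<comment> \<open>The kernel of \<open>phi u\<close> lies in that of \<open>I2\<close>, so
      \<open>I2\<close> is a multiple of the square of \<open>phi u\<close> and all its 2 by 2
      minors vanish.\<close>
    have rank1: "X.I2 u a b = phi u a * phi u b * (X.I2 u e e / (phi u e * phi u e))" for a b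
    proof -
      have *: "X.I2 u a b = (phi u a / phi u e) * X.I2 u e b" for a b
        using ker[of "a - (phi u a / phi u e) *\<^sub>R e" b] nz by (simp add: lin u X.I2_simps)
      show ?thesis
        using *[of a b] *[of b e] X.I2_sym[OF u, of e b] by simp
    qed
    obtain a b c d where "X.I2 u b c * X.I2 u a d - X.I2 u a c * X.I2 u b d \<noteq> 0"
      using curved[OF u] by blast
    then show False by (subst (asm) (1 2 3 4) rank1) simp
  qed
  have phi0: "phi u a = 0" if u: "u \<in> U" for u a
  proof (rule ccontr)
    assume nz: "phi u a \<noteq> 0"
    define W where "W = {x \<in> U. phi x a \<in> - {0}}"
    have "open W"
      using continuous_open_preimage[OF C_inf_on_continuous[OF smooth_phi[of a]] X.open_U
          open_Compl[OF closed_singleton[of 0]]]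
      by (simp add: W_def vimage_def Int_def)
    moreover have "u \<in> W" using nz u by (simp add: W_def)
    moreover have "L x = 1" if "x \<in> W" for x using L1[of x a] that by (simp add: W_def)
    ultimately have "dir a L u = 0"
      using dir_cong[of W u L "\<lambda>_. 1" a] by (simp add: dir_const)
    then show False using nz by (simp add: phi_def)
  qed
  have "grad x = 0" if "x \<in> U" for x
    by (rule X.I1_eqI[OF that]) (simp add: I1_grad phi0 that X.I1_simps)
  then have GG: "Y.Gam x a b = X.Gam x a b" if "x \<in> U" for x a b
    using Gam_bar[OF that] phi0[OF that] that by simp
  have dGG: "dir c (\<lambda>x. Y.Gam x a b) u = dir c (\<lambda>x. X.Gam x a b) u" for a b c
    by (rule dir_cong[OF X.open_U u]) (simp add: GG)
  \<comment> \<open>Equal connections have equal curvature vectors, whereas on the right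
    \<open>I2\<close> is multiplied by \<open>L\<close> and \<open>shape\<close> is
    unchanged.\<close>
  have "\<epsilon> *\<^sub>R (Y.I2 u a b *\<^sub>R Y.shape u c - Y.I2 u c b *\<^sub>R Y.shape u a)
    = \<epsilon> *\<^sub>R (X.I2 u a b *\<^sub>R X.shape u c - X.I2 u c b *\<^sub>R X.shape u a)" for a b c
    unfolding X.gauss_equation[OF u, symmetric] Y.gauss_equation[OF u, symmetric] dGG GG[OF u] ..
  then have "Y.I2 u a b *\<^sub>R Y.shape u c - Y.I2 u c b *\<^sub>R Y.shape u a
    = X.I2 u a b *\<^sub>R X.shape u c - X.I2 u c b *\<^sub>R X.shape u a" for a b c
    using X.eps by auto
  then have *: "(L u - 1) *\<^sub>R (X.I2 u a b *\<^sub>R X.shape u c - X.I2 u c b *\<^sub>R X.shape u a) = 0" for a b c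
    by (simp add: I2_bar shape_bar u algebra_simps)
  obtain a b c d where nz: "X.I2 u b c * X.I2 u a d - X.I2 u a c * X.I2 u b d \<noteq> 0"
    using curved[OF u] by blast
  have "X.I1 u (X.I2 u b c *\<^sub>R X.shape u a - X.I2 u a c *\<^sub>R X.shape u b) d \<noteq> 0"
    using nz by (simp add: X.I1_simps u X.I1_shape)
  then have "X.I2 u b c *\<^sub>R X.shape u a - X.I2 u a c *\<^sub>R X.shape u b \<noteq> 0"
    using X.I1_simps(9)[OF u] by metis
  then show ?thesis using *[of b c a] by simp
qed

text \<open>\<open>T u\<close> carries the frame of \<open>X\<close> at \<open>u\<close> to that of
  \<open>Y\<close>. Both frames obey the same structure equations, so \<open>T u v\<close> does not
  depend on \<open>u\<close> in the connected domain; as \<open>T\<close> maps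
  \<open>dir a X u\<close> to \<open>dir a Y u\<close>, the difference of \<open>Y\<close> and
  \<open>T\<close> after \<open>X\<close> is constant.\<close>

lemma rigidity:
  assumes L1: "\<And>u. u \<in> U \<Longrightarrow> L u = 1" and conn: "connected U"
  obtains T c where "linear T" "\<And>v w. pmetric S (T v) (T w) = pmetric S v w"
    "\<And>u. u \<in> U \<Longrightarrow> Y u = T (X u) + c"
proof (cases "U = {}")
  case True
  then show thesis using that[of id 0] by (simp add: linear_id)
next
  case False
  then obtain u0 where u0: "u0 \<in> U" by blast
  have I1: "Y.I1 u a b = X.I1 u a b" and I2: "Y.I2 u a b = X.I2 u a b" if "u \<in> U" for u a b
    using I1_bar I2_bar L1 that by auto
  have phi0: "phi u a = 0" if "u \<in> U" for u a
    using dir_cong[OF X.open_U that, of L "\<lambda>_. 1" a] L1 by (simp add: phi_def dir_const)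
  have "grad x = 0" if "x \<in> U" for x
    by (rule X.I1_eqI[OF that]) (simp add: I1_grad phi0 that X.I1_simps)
  then have GG: "Y.Gam x a b = X.Gam x a b" if "x \<in> U" for x a b
    using Gam_bar[OF that] phi0[OF that] that by simp
  define T where "T u v = dir (X.coord u v) Y u + (\<epsilon> * pmetric S v (n u)) *\<^sub>R m u" for u v
  have dT: "((\<lambda>u. T u v) has_derivative (\<lambda>c. 0)) (at u)" if u: "u \<in> U" for u v
  proof -
    define w s where "w = (\<lambda>u. X.coord u v)" and "s = (\<lambda>u. \<epsilon> * pmetric S v (n u))"
    have w: "w differentiable (at u)"
      unfolding w_def by (rule C_inf_on_differentiable[OF X.smooth_coord[OF C_inf_on_const[OF X.open_U]] u])
    have s: "s differentiable (at u)"
      unfolding s_def by (intro C_inf_on_differentiable[OF _ u] C_inf_on_mult C_inf_on_const X.open_U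
          C_inf_on_bilinear[OF bounded_bilinear_pmetric] X.smooth_n)
    \<comment> \<open>This sum is the fixed vector \<open>v\<close> written in the moving frame of
      \<open>X\<close>. That its derivative is zero gives equations for \<open>w\<close> and
      \<open>s\<close> involving only data common to both hypersurfaces.\<close>
    have "dir c (\<lambda>x. dir (w x) X x + s x *\<^sub>R n x) u = 0" for c
      by (rule X.dir_const_on[OF _ u]) (simp add: w_def s_def X.frame_expansion[symmetric])
    then have "dir (dir c w u + X.Gam u c (w u) - (\<epsilon> * s u) *\<^sub>R X.shape u c) X u
        + (dir c s u + X.I2 u c (w u)) *\<^sub>R n u = dir 0 X u + 0 *\<^sub>R n u" for c
      using X.dir_frame[OF u w s] by (simp add: X.dX u)
    note frame0 = X.frame_unique[OF u this]
    have "dir c (\<lambda>x. dir (w x) Y x + s x *\<^sub>R m x) u = 0" for c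
      using Y.dir_frame[OF u w s, of c] frame0[of c] by (simp add: GG I2 shape_bar u Y.dX)
    moreover have "T u v = dir (w u) Y u + s u *\<^sub>R m u" for u
      by (simp add: T_def w_def s_def)
    ultimately show ?thesis
      using has_derivative_dir[OF Y.dir_frame_diff[OF u w s]] by simp
  qed
  have T_const: "T u v = T u0 v" if "u \<in> U" for u v
    using has_derivative_zero_unique_connected[OF X.open_U conn dT that u0] .
  have lin: "linear (T u0)"
    by (rule linearI)
      (simp_all add: T_def linear_add[OF X.coord_linear[OF u0]] linear_scale[OF X.coord_linear[OF u0]]
        Y.dX u0 pmetric_simps algebra_simps)
  have T_X: "T u (dir a X u) = dir a Y u" if "u \<in> U" for u a
    by (simp add: T_def X.coord_dir that pmetric_sym[of S "dir a X u"] X.normal)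
  have iso: "pmetric S (T u0 v) (T u0 w) = pmetric S v w" for v w
  proof -
    have *: "pmetric S v w = X.I1 u0 (X.coord u0 v) (X.coord u0 w) + \<epsilon> * pmetric S v (n u0) * pmetric S w (n u0)" for v w
    proof -
      have "pmetric S v w = pmetric S v (dir (X.coord u0 w) X u0 + (\<epsilon> * pmetric S w (n u0)) *\<^sub>R n u0)"
        by (rule arg_cong[OF X.frame_expansion[OF u0]])
      then show ?thesis
        by (simp add: pmetric_simps X.I1_coord u0)
    qed
    have "pmetric S (T u0 v) (T u0 w) = Y.I1 u0 (X.coord u0 v) (X.coord u0 w)
       + (\<epsilon> * pmetric S v (n u0)) * (\<epsilon> * pmetric S w (n u0)) * \<epsilon>"
      by (simp add: T_def pmetric_simps Y.normal Y.unit u0 Y.I1_def pmetric_sym[of S "dir _ Y u0" "m u0"])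
    also have "\<dots> = pmetric S v w"
      using *[of v w] X.eps by (auto simp: I1 u0)
    finally show ?thesis .
  qed
  define c where "c = Y u0 - T u0 (X u0)"
  have "Y u - T u0 (X u) = c" if "u \<in> U" for u
  proof -
    have "((\<lambda>u. Y u - T u0 (X u)) has_derivative (\<lambda>a. 0)) (at u)" if u: "u \<in> U" for u
    proof -
      have "((\<lambda>u. Y u - T u0 (X u)) has_derivative (\<lambda>a. dir a Y u - T u0 (dir a X u))) (at u)"
        using lin by (intro has_derivative_diff has_derivative_dir Y.differentiable_X[OF u]
            bounded_linear.has_derivative[of "T u0"] X.differentiable_X[OF u])
          (simp add: linear_conv_bounded_linear)
      then show ?thesis using T_X[OF u] T_const[OF u] by simp
    qed
    from has_derivative_zero_unique_connected[OF X.open_U conn this that u0]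
    show ?thesis by (simp add: c_def)
  qed
  then show thesis using that[OF lin iso, of c] by (simp add: diff_eq_eq add.commute)
qed

end

section \<open>The curvature tensor of the induced metric\<close>

context patch
begin

lemma induced_metric_component: "induced_metric S X u $ i $ j = I1 u (axis i 1) (axis j 1)"
  by (simp add: induced_metric_def I1_def dir_def)

text \<open>By \<open>koszul\<close> the sum is the inverse metric applied to the lowered vector
  \<open>Gam\<close>.\<close>

lemma christoffel_eq_Gam:
  assumes u: "u \<in> U"
  shows "christoffel (induced_metric S X) k i j u = Gam u (axis i 1) (axis j 1) $ k"
proof -
  let ?G = "induced_metric S X u" and ?v = "Gam u (axis i 1) (axis j 1)"
  have "christoffel (induced_metric S X) k i j u = (\<Sum>l\<in>UNIV. matrix_inv ?G $ k $ l * (2 * I1 u ?v (axis l 1))) / 2"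
    unfolding christoffel_def partial_def dir_def[symmetric] induced_metric_component koszul[OF u] ..
  also have "\<dots> = (\<Sum>l\<in>UNIV. matrix_inv ?G $ k $ l * (?G *v ?v) $ l)"
    by (simp add: induced_metric_mult[OF u] sum_divide_distrib)
  also have "\<dots> = (matrix_inv ?G *v (?G *v ?v)) $ k"
    by (simp add: matrix_vector_mult_def)
  also have "\<dots> = ?v $ k"
    by (simp add: matrix_vector_mul_assoc matrix_mul_matrix_inv invertible_induced_metric u)
  finally show ?thesis .
qed

lemma partial_christoffel:
  assumes u: "u \<in> U"
  shows "partial i (christoffel (induced_metric S X) l j k) u =
    dir (axis i 1) (\<lambda>x. Gam x (axis j 1) (axis k 1)) u $ l"
proof -
  have "partial i (christoffel (induced_metric S X) l j k) u = dir (axis i 1) (\<lambda>x. Gam x (axis j 1) (axis k 1) $ l) u"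
    unfolding partial_def dir_def[symmetric]
    by (rule dir_cong[OF open_U u]) (rule christoffel_eq_Gam)
  also have "\<dots> = dir (axis i 1) (\<lambda>x. Gam x (axis j 1) (axis k 1)) u $ l"
    by (rule dir_bounded_linear[OF bounded_linear_vec_nth differentiable_Gam[OF u]])
  finally show ?thesis .
qed

lemma sum_christoffel:
  assumes u: "u \<in> U"
  shows "(\<Sum>m\<in>UNIV. christoffel (induced_metric S X) l i m u * v $ m) = Gam u (axis i 1) v $ l"
proof -
  note lin = Gam_linear_right[OF u, of "axis i 1"]
  have "Gam u (axis i 1) v = Gam u (axis i 1) (\<Sum>m\<in>UNIV. v $ m *\<^sub>R axis m 1)"
    using basis_expansion[of v] by (simp add: scalar_mult_eq_scaleR)
  also have "\<dots> = (\<Sum>m\<in>UNIV. v $ m *\<^sub>R Gam u (axis i 1) (axis m 1))"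
    by (simp add: linear_sum[OF lin] linear_scale[OF lin])
  finally show ?thesis
    by (simp add: christoffel_eq_Gam u mult.commute)
qed

lemma riemann_up_eq:
  assumes u: "u \<in> U"
  shows "riemann_up (induced_metric S X) l i j k u =
    (\<epsilon> *\<^sub>R (I2 u (axis j 1) (axis k 1) *\<^sub>R shape u (axis i 1)
      - I2 u (axis i 1) (axis k 1) *\<^sub>R shape u (axis j 1))) $ l"
  unfolding gauss_equation[OF u, symmetric] riemann_up_def sum_subtractf
  by (simp add: partial_christoffel u christoffel_eq_Gam[OF u, of _ j k] christoffel_eq_Gam[OF u, of _ i k]
      sum_christoffel)

text \<open>Turns nonvanishing curvature at a point into a nonzero 2 by 2 minor of
  \<open>I2\<close>, which persists nearby by continuity.\<close>

lemma riemann_eq: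
  assumes u: "u \<in> U"
  shows "riemann (induced_metric S X) i j k l u = \<epsilon> *
    (I2 u (axis j 1) (axis k 1) * I2 u (axis i 1) (axis l 1)
      - I2 u (axis i 1) (axis k 1) * I2 u (axis j 1) (axis l 1))"
proof -
  define v where "v = \<epsilon> *\<^sub>R (I2 u (axis j 1) (axis k 1) *\<^sub>R shape u (axis i 1)
      - I2 u (axis i 1) (axis k 1) *\<^sub>R shape u (axis j 1))"
  have "riemann (induced_metric S X) i j k l u = (\<Sum>m\<in>UNIV. v $ m * I1 u (axis m 1) (axis l 1))"
    by (simp only: riemann_def riemann_up_eq[OF u] v_def[symmetric] induced_metric_component)
  also have "\<dots> = (induced_metric S X u *v v) $ l"
    by (simp add: matrix_vector_mult_def induced_metric_component I1_sym mult.commute)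
  also have "\<dots> = I1 u v (axis l 1)" by (rule induced_metric_mult[OF u])
  finally show ?thesis by (simp add: v_def I1_simps u I1_shape)
qed

lemma restrict:
  assumes "open B" "B \<subseteq> U"
  shows "patch S B X n \<epsilon>"
  using assms C_inf_on_subset[OF smooth_X] C_inf_on_subset[OF smooth_n] card eps normal unit nondeg
  by unfold_locales (auto 0 3)

end

section \<open>Local parametrizations\<close>

lemma smooth_on_open: "open U \<Longrightarrow> smooth_on U f \<longleftrightarrow> C_inf_on U f"
proof
  assume U: "open U" and f: "smooth_on U f"
  show "C_inf_on U f"
  proof (rule C_inf_on_local[OF U])
    fix x assume x: "x \<in> U"
    then obtain W F where W: "open W" "x \<in> W" "\<forall>k. C_k_on k W F" "\<forall>x\<in>U \<inter> W. F x = f x"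
      using f unfolding smooth_on_def by blast
    then have "C_inf_on (U \<inter> W) F"
      using U C_inf_on_subset[of W F "U \<inter> W"] by (auto simp: C_inf_on_def)
    then have "C_inf_on (U \<inter> W) f" by (rule C_inf_on_cong) (use W in auto)
    then show "\<exists>W. x \<in> W \<and> C_inf_on W f" using x W by blast
  qed
next
  assume "C_inf_on U f"
  then show "smooth_on U f" unfolding smooth_on_def C_inf_on_def by blast
qed

lemma smooth_onE:
  assumes "smooth_on A f" "p \<in> A"
  obtains W F where "p \<in> W" "C_inf_on W F" "\<And>x. x \<in> A \<Longrightarrow> x \<in> W \<Longrightarrow> F x = f x"
proof -
  obtain W F where "open W" "p \<in> W" "\<forall>k. C_k_on k W F" "\<forall>x\<in>A \<inter> W. F x = f x"
    using assms unfolding smooth_on_def by blast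
  then show thesis using that[of W F] by (auto simp: C_inf_on_def)
qed

lemma smooth_onI:
  assumes "\<And>p. p \<in> A \<Longrightarrow> \<exists>W F. p \<in> W \<and> C_inf_on W F \<and> (\<forall>x\<in>A \<inter> W. F x = f x)"
  shows "smooth_on A f"
  using assms unfolding smooth_on_def C_inf_on_def by meson

lemma smooth_on_subset: "smooth_on A f \<Longrightarrow> B \<subseteq> A \<Longrightarrow> smooth_on B f"
  unfolding smooth_on_def by (meson Int_mono order_refl subsetD)

lemma smooth_on_cong: "smooth_on A f \<Longrightarrow> (\<And>x. x \<in> A \<Longrightarrow> f x = g x) \<Longrightarrow> smooth_on A g"
  unfolding smooth_on_def by (metis IntD1)

lemma smooth_on_compose:
  fixes f :: "'a::euclidean_space \<Rightarrow> 'b::euclidean_space"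
  assumes f: "smooth_on A f" and g: "smooth_on B g" and AB: "f ` A \<subseteq> B"
  shows "smooth_on A (\<lambda>x. g (f x))"
proof (rule smooth_onI)
  fix p assume p: "p \<in> A"
  obtain W F where W: "p \<in> W" "C_inf_on W F" "\<And>x. x \<in> A \<Longrightarrow> x \<in> W \<Longrightarrow> F x = f x"
    using smooth_onE[OF f p] by blast
  obtain W' G where W': "f p \<in> W'" "C_inf_on W' G" "\<And>x. x \<in> B \<Longrightarrow> x \<in> W' \<Longrightarrow> G x = g x"
    using smooth_onE[OF g] p AB by blast
  define V where "V = {x \<in> W. F x \<in> W'}"
  have "open V"
    using continuous_open_preimage[OF C_inf_on_continuous[OF W(2)] C_inf_on_open[OF W(2)] C_inf_on_open[OF W'(2)]]
    by (simp add: V_def vimage_def Int_def)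
  then have "C_inf_on V (\<lambda>x. G (F x))"
    by (intro C_inf_on_compose[of V F W' G] C_inf_on_subset[OF W(2)] W'(2)) (auto simp: V_def)
  moreover have "p \<in> V" using W W' p by (simp add: V_def)
  moreover have "\<forall>x\<in>A \<inter> V. G (F x) = g (f x)" using W W' AB by (auto simp: V_def)
  ultimately show "\<exists>W F. p \<in> W \<and> C_inf_on W F \<and> (\<forall>x\<in>A \<inter> W. F x = g (f x))" by blast
qed

lemma smooth_on_differentiable:
  assumes "smooth_on A f" "p \<in> A"
  shows "f differentiable (at p within A)"
proof -
  obtain W F where W: "p \<in> W" "C_inf_on W F" "\<And>x. x \<in> A \<Longrightarrow> x \<in> W \<Longrightarrow> F x = f x"
    using smooth_onE[OF assms] by blast
  then obtain d where d: "d > 0" "ball p d \<subseteq> W"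
    using C_inf_on_open open_contains_ball by blast
  have "(F has_derivative (\<lambda>a. dir a F p)) (at p within A)"
    using has_derivative_at_withinI[OF has_derivative_dir[OF C_inf_on_differentiable[OF W(2,1)]]] .
  then have "(f has_derivative (\<lambda>a. dir a F p)) (at p within A)"
  proof (rule has_derivative_transform_within[OF _ d(1) assms(2)])
    fix x assume "x \<in> A" "dist x p < d"
    then show "F x = f x" using W(3) d(2) by (auto simp: subset_iff dist_commute)
  qed
  then show ?thesis by (auto simp: differentiable_def)
qed

lemma smooth_on_continuous_on: "smooth_on A f \<Longrightarrow> continuous_on A f"
  using smooth_on_differentiable differentiable_imp_continuous_within
  by (metis continuous_on_eq_continuous_within)

section \<open>Restriction and composition of diffeomorphisms\<close>

lemma diffeomorphism_homeomorphism:
  assumes "diffeomorphism A B f"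
  shows "homeomorphism A B f (inv_into A f)"
  using assms unfolding diffeomorphism_def homeomorphism_def
  by (auto simp: smooth_on_continuous_on bij_betw_def inv_into_into f_inv_into_f)

lemma diffeomorphism_restrict:
  assumes "diffeomorphism A B f" "V \<subseteq> A"
  shows "diffeomorphism V (f ` V) f"
proof -
  have inj: "inj_on f A" using assms by (simp add: diffeomorphism_def bij_betw_def)
  have "smooth_on (f ` V) (inv_into V f)"
  proof (rule smooth_on_cong)
    show "smooth_on (f ` V) (inv_into A f)"
      using assms by (auto simp: diffeomorphism_def bij_betw_def intro: smooth_on_subset)
    show "inv_into A f y = inv_into V f y" if y: "y \<in> f ` V" for y
    proof -
      obtain x where "x \<in> V" "y = f x" using y by auto
      then show ?thesis using inj assms(2) inj_on_subset[OF inj assms(2)]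
        by (simp add: inv_into_f_f subsetD)
    qed
  qed
  moreover have "smooth_on V f" using assms smooth_on_subset unfolding diffeomorphism_def by blast
  ultimately show ?thesis
    using inj_on_subset[OF inj assms(2)] by (simp add: diffeomorphism_def bij_betw_def)
qed

lemma diffeomorphism_compose:
  fixes f :: "'a::euclidean_space \<Rightarrow> 'b::euclidean_space" and g :: "'b \<Rightarrow> 'c::euclidean_space"
  assumes f: "diffeomorphism A B f" and g: "diffeomorphism B C g"
  shows "diffeomorphism A C (\<lambda>x. g (f x))"
proof -
  have bij: "bij_betw f A B" "bij_betw g B C" using f g by (auto simp: diffeomorphism_def)
  then have fg: "bij_betw (\<lambda>x. g (f x)) A C"
    using bij_betw_trans[OF bij] by (simp add: comp_def)
  have "smooth_on C (inv_into A (\<lambda>x. g (f x)))"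
  proof (rule smooth_on_cong)
    show "smooth_on C (\<lambda>y. inv_into A f (inv_into B g y))"
      using f g bij_betw_imp_surj_on[OF bij_betw_inv_into[OF bij(2)]]
      by (intro smooth_on_compose[of C "inv_into B g" B "inv_into A f"]) (auto simp: diffeomorphism_def)
    fix y assume y: "y \<in> C"
    have 1: "inv_into B g y \<in> B" "g (inv_into B g y) = y"
      using y bij(2) by (auto simp: bij_betw_def inv_into_into f_inv_into_f)
    have 2: "inv_into A f (inv_into B g y) \<in> A" "f (inv_into A f (inv_into B g y)) = inv_into B g y"
      using 1 bij(1) by (auto simp: bij_betw_def inv_into_into f_inv_into_f)
    show "inv_into A f (inv_into B g y) = inv_into A (\<lambda>x. g (f x)) y"
      using inv_into_f_f[OF bij_betw_imp_inj_on[OF fg] 2(1)] 1 2 by simp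
  qed
  moreover have "smooth_on A (\<lambda>x. g (f x))"
    using f g by (intro smooth_on_compose[of A f B g]) (auto simp: diffeomorphism_def bij_betw_def)
  ultimately show ?thesis using fg by (simp add: diffeomorphism_def)
qed

lemma local_param_compose:
  assumes \<phi>: "local_param M U \<phi>" and f: "diffeomorphism M M' f"
  shows "local_param M' U (\<lambda>x. f (\<phi> x))"
proof -
  have op: "openin (top_of_set M) (\<phi> ` U)" and U: "open U" and d: "diffeomorphism U (\<phi> ` U) \<phi>"
    using \<phi> by (auto simp: local_param_def)
  have sub: "\<phi> ` U \<subseteq> M" using op openin_imp_subset by blast
  have im: "(\<lambda>x. f (\<phi> x)) ` U = f ` \<phi> ` U" by auto
  have "openin (top_of_set M') (f ` \<phi> ` U)"
    by (rule homeomorphism_imp_open_map[OF diffeomorphism_homeomorphism[OF f] op])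
  moreover have "diffeomorphism U (f ` \<phi> ` U) (\<lambda>x. f (\<phi> x))"
    by (rule diffeomorphism_compose[OF d diffeomorphism_restrict[OF f sub]])
  ultimately show ?thesis using U by (simp add: local_param_def im)
qed

section \<open>Charts, tangent spaces and differentials\<close>

lemma local_param_smooth: "local_param M U \<phi> \<Longrightarrow> C_inf_on U \<phi>"
  using smooth_on_open unfolding local_param_def diffeomorphism_def by blast

lemma local_param_image: "local_param M U \<phi> \<Longrightarrow> u \<in> U \<Longrightarrow> \<phi> u \<in> M"
  unfolding local_param_def using openin_imp_subset by blast

lemma local_param_open_image:
  assumes \<phi>: "local_param M U \<phi>" and V: "open V" "V \<subseteq> U"
  shows "openin (top_of_set M) (\<phi> ` V)"
proof -
  have "openin (top_of_set U) V" using V by (simp add: open_subset)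
  then have "openin (top_of_set (\<phi> ` U)) (\<phi> ` V)"
    using \<phi> homeomorphism_imp_open_map[OF diffeomorphism_homeomorphism] unfolding local_param_def by blast
  then show ?thesis using \<phi> openin_trans unfolding local_param_def by blast
qed

text \<open>\<open>F\<close> extends the inverse chart to an open set of the ambient space, where it
  can be differentiated and composed with curves. Its differential inverts that of \<phi> from the
  left, so charts are immersions.\<close>

lemma local_param_left_inverse:
  assumes \<phi>: "local_param M U \<phi>" and u: "u \<in> U"
  shows "\<exists>W F. \<phi> u \<in> W \<and> C_inf_on W F \<and> (\<forall>x\<in>U. \<phi> x \<in> W \<longrightarrow> F (\<phi> x) = x)
    \<and> (\<forall>a. dir (dir a \<phi> u) F (\<phi> u) = a)"
proof -
  have inj: "inj_on \<phi> U" and sm: "smooth_on (\<phi> ` U) (inv_into U \<phi>)"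
    using \<phi> by (auto simp: local_param_def diffeomorphism_def bij_betw_def)
  note C = local_param_smooth[OF \<phi>]
  have "\<phi> u \<in> \<phi> ` U" using u by simp
  from smooth_onE[OF sm this] obtain W F where
    W: "\<phi> u \<in> W" "C_inf_on W F" "\<And>y. y \<in> \<phi> ` U \<Longrightarrow> y \<in> W \<Longrightarrow> F y = inv_into U \<phi> y"
    by blast
  have F: "F (\<phi> x) = x" if "x \<in> U" "\<phi> x \<in> W" for x
    using W(3)[of "\<phi> x"] that inj by (simp add: inv_into_f_f)
  define V where "V = {x \<in> U. \<phi> x \<in> W}"
  have V: "open V" "u \<in> V"
    using continuous_open_preimage[OF C_inf_on_continuous[OF C] C_inf_on_open[OF C] C_inf_on_open[OF W(2)]] u W
    by (simp_all add: V_def vimage_def Int_def)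
  have "dir (dir a \<phi> u) F (\<phi> u) = a" for a
  proof -
    have "dir a (\<lambda>x. F (\<phi> x)) u = dir (dir a \<phi> u) F (\<phi> u)"
      by (rule dir_eqI, rule has_derivative_compose[OF has_derivative_dir has_derivative_dir])
        (use C_inf_on_differentiable[OF C u] C_inf_on_differentiable[OF W(2,1)] in auto)
    moreover have "dir a (\<lambda>x. F (\<phi> x)) u = dir a (\<lambda>x. x) u"
      by (rule dir_cong[OF V]) (auto simp: V_def F)
    ultimately show ?thesis by (simp add: dir_def)
  qed
  with W(1,2) F show ?thesis by blast
qed

text \<open>The image of the chart is relatively open, so a curve in \<open>M\<close> through
  \<open>\<phi> u\<close> stays in it for small times and is the image of the parameter curve
  \<open>F (\<gamma> t)\<close>. Conversely, straight lines in \<open>U\<close> realize every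
  \<open>dir a \<phi> u\<close>.\<close>

lemma tangent_space_local_param:
  fixes \<phi> :: "real ^ 'n::finite \<Rightarrow> real ^ 'N::finite"
  assumes \<phi>: "local_param M U \<phi>" and u: "u \<in> U"
  shows "tangent_space M (\<phi> u) = range (\<lambda>a. dir a \<phi> u)"
proof (intro equalityI subsetI)
  note C = local_param_smooth[OF \<phi>]
  have U: "open U" using C C_inf_on_open by blast
  note d\<phi> = has_derivative_dir[OF C_inf_on_differentiable[OF C u]]
  {
    fix v assume "v \<in> tangent_space M (\<phi> u)"
    then obtain \<gamma> e where e: "e > 0" and \<gamma>: "smooth_on {-e<..<e} \<gamma>" "\<gamma> ` {-e<..<e} \<subseteq> M" "\<gamma> 0 = \<phi> u"
      and v: "(\<gamma> has_vector_derivative v) (at (0::real))"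
      unfolding tangent_space_def by blast
    obtain W F where W: "\<phi> u \<in> W" "C_inf_on W F" "\<forall>x\<in>U. \<phi> x \<in> W \<longrightarrow> F (\<phi> x) = x"
      using local_param_left_inverse[OF \<phi> u] by blast
    obtain O' where O': "open O'" "\<phi> ` U = M \<inter> O'"
      using \<phi> by (auto simp: local_param_def openin_open)
    have cont: "continuous_on {-e<..<e} \<gamma>" using smooth_on_continuous_on[OF \<gamma>(1)] .
    define J where "J = {t \<in> {-e<..<e}. \<gamma> t \<in> W \<inter> O'}"
    have J: "open J"
      using continuous_open_preimage[OF cont _ open_Int[OF C_inf_on_open[OF W(2)] O'(1)]]
      by (simp add: J_def vimage_def Int_def)
    have "\<phi> u \<in> O'" using O'(2) u by blast
    then have J0: "0 \<in> J" using e W(1) \<gamma>(3) by (simp add: J_def)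
    have recover: "\<phi> (F (\<gamma> t)) = \<gamma> t" if "t \<in> J" for t
    proof -
      have "\<gamma> t \<in> \<phi> ` U" "\<gamma> t \<in> W" using that \<gamma>(2) O'(2) by (auto simp: J_def)
      then show ?thesis using W(3) by auto
    qed
    define a where "a = dir v F (\<phi> u)"
    have "F (\<phi> u) = u" using W(1,3) u by blast
    have "((\<lambda>t. F (\<gamma> t)) has_derivative (\<lambda>s. dir (s *\<^sub>R v) F (\<gamma> 0))) (at 0)"
      by (rule has_derivative_compose[OF v[unfolded has_vector_derivative_def] has_derivative_dir])
        (use C_inf_on_differentiable[OF W(2,1)] \<gamma>(3) in auto)
    then have "((\<lambda>t. \<phi> (F (\<gamma> t))) has_derivative (\<lambda>s. dir (dir (s *\<^sub>R v) F (\<gamma> 0)) \<phi> u)) (at 0)"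
      by (rule has_derivative_compose) (use d\<phi> \<gamma>(3) \<open>F (\<phi> u) = u\<close> in simp)
    then have "(\<gamma> has_derivative (\<lambda>s. dir (dir (s *\<^sub>R v) F (\<gamma> 0)) \<phi> u)) (at 0)"
      by (rule has_derivative_transform_within_open[OF _ J J0]) (rule recover)
    then have "(\<lambda>s. s *\<^sub>R v) = (\<lambda>s. dir (dir (s *\<^sub>R v) F (\<gamma> 0)) \<phi> u)"
      using has_derivative_unique v[unfolded has_vector_derivative_def] by blast
    then have "v = dir a \<phi> u" unfolding a_def using \<gamma>(3) by (metis scaleR_one)
    then show "v \<in> range (\<lambda>a. dir a \<phi> u)" by blast
  next
    fix v assume "v \<in> range (\<lambda>a. dir a \<phi> u)"
    then obtain a where a: "v = dir a \<phi> u" by blast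
    define l where "l = (\<lambda>t::real. u + t *\<^sub>R a)"
    have l: "C_inf_on UNIV l"
      unfolding l_def
      by (intro C_inf_on_add C_inf_on_scaleR C_inf_on_const C_inf_on_linear open_UNIV bounded_linear_ident)
    have "open (l -` U)" "0 \<in> l -` U"
      using open_vimage[OF U] C_inf_on_continuous[OF l] u by (auto simp: l_def)
    then obtain e where e: "e > 0" "ball 0 e \<subseteq> l -` U"
      using open_contains_ball by blast
    then have sub: "l ` {-e<..<e} \<subseteq> U"
      by (simp add: ball_eq_greaterThanLessThan image_subset_iff_subset_vimage)
    have "C_inf_on {-e<..<e} (\<lambda>t. \<phi> (l t))"
      by (rule C_inf_on_compose[OF C_inf_on_subset[OF l] C sub]) auto
    then have "smooth_on {-e<..<e} (\<lambda>t. \<phi> (l t))" by (simp add: smooth_on_open)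
    moreover have "(\<lambda>t. \<phi> (l t)) ` {-e<..<e} \<subseteq> M"
      using sub local_param_image[OF \<phi>] by blast
    moreover have "((\<lambda>t. \<phi> (l t)) has_vector_derivative v) (at 0)"
    proof -
      have "(l has_derivative (\<lambda>t. t *\<^sub>R a)) (at 0)"
        unfolding l_def by (auto intro!: derivative_eq_intros)
      then have "((\<lambda>t. \<phi> (l t)) has_derivative (\<lambda>t. dir (t *\<^sub>R a) \<phi> u)) (at 0)"
        by (rule has_derivative_compose) (use d\<phi> in \<open>simp add: l_def\<close>)
      then show ?thesis
        by (simp add: has_vector_derivative_def a linear_scale[OF dir_linear_arg[OF C u]])
    qed
    moreover have "\<phi> (l 0) = \<phi> u" by (simp add: l_def)
    ultimately show "v \<in> tangent_space M (\<phi> u)"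
      unfolding tangent_space_def using e(1) by blast
  }
qed

text \<open>\<open>frechet_derivative\<close> within \<open>M\<close> selects one of possibly many
  derivatives; by the chain rule each of them has the same value on tangent vectors.\<close>

lemma frechet_derivative_within_local_param:
  assumes \<phi>: "local_param M U \<phi>" and u: "u \<in> U" and g: "smooth_on M g"
  shows "frechet_derivative g (at (\<phi> u) within M) (dir a \<phi> u) = dir a (\<lambda>x. g (\<phi> x)) u"
proof -
  note C = local_param_smooth[OF \<phi>]
  have U: "open U" using C C_inf_on_open by blast
  have "(g has_derivative frechet_derivative g (at (\<phi> u) within M)) (at (\<phi> u) within M)"
    using smooth_on_differentiable[OF g local_param_image[OF \<phi> u]] frechet_derivative_works by blast
  then have "(g has_derivative frechet_derivative g (at (\<phi> u) within M)) (at (\<phi> u) within \<phi> ` U)"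
    by (rule has_derivative_subset) (use local_param_image[OF \<phi>] in blast)
  moreover have "(\<phi> has_derivative (\<lambda>a. dir a \<phi> u)) (at u within U)"
    using has_derivative_at_withinI[OF has_derivative_dir[OF C_inf_on_differentiable[OF C u]]] .
  ultimately have "((g \<circ> \<phi>) has_derivative (frechet_derivative g (at (\<phi> u) within M) \<circ> (\<lambda>a. dir a \<phi> u))) (at u within U)"
    by (intro diff_chain_within)
  then show ?thesis
    using dir_eqI[of "g \<circ> \<phi>"] by (simp add: at_within_open[OF u U] comp_def)
qed

lemma patch_local_param:
  fixes \<phi> :: "real ^ 'n::finite \<Rightarrow> real ^ 'N::finite"
  assumes M: "hypersurface TYPE('n) S M" and \<nu>: "unit_normal_field S M \<epsilon> \<nu>" and \<phi>: "local_param M U \<phi>"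
  shows "patch S U \<phi> (\<lambda>u. \<nu> (\<phi> u)) \<epsilon>"
proof
  note C = local_param_smooth[OF \<phi>]
  have U: "open U" using C C_inf_on_open by blast
  show "CARD('N) = CARD('n) + 1" using M by (simp add: hypersurface_def)
  show "C_inf_on U \<phi>" by fact
  have "smooth_on U (\<lambda>u. \<nu> (\<phi> u))"
    using C \<nu> local_param_image[OF \<phi>] unfolding unit_normal_field_def
    by (intro smooth_on_compose[of U \<phi> M \<nu>]) (auto simp: smooth_on_open U)
  then show "C_inf_on U (\<lambda>u. \<nu> (\<phi> u))" by (simp add: smooth_on_open U)
  show "\<epsilon> \<in> {1, -1}" using \<nu> by (simp add: unit_normal_field_def)
  fix u assume u: "u \<in> U"
  note T = tangent_space_local_param[OF \<phi> u]
  show "pmetric S (\<nu> (\<phi> u)) (dir a \<phi> u) = 0" for a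
    using \<nu> local_param_image[OF \<phi> u] T by (auto simp: unit_normal_field_def)
  show "pmetric S (\<nu> (\<phi> u)) (\<nu> (\<phi> u)) = \<epsilon>"
    using \<nu> local_param_image[OF \<phi> u] by (auto simp: unit_normal_field_def)
  fix a assume a: "\<And>b. pmetric S (dir a \<phi> u) (dir b \<phi> u) = 0"
  have "\<forall>x\<in>range (\<lambda>a. dir a \<phi> u). (\<forall>y\<in>range (\<lambda>a. dir a \<phi> u). pmetric S x y = 0) \<longrightarrow> x = 0"
    using M local_param_image[OF \<phi> u] unfolding hypersurface_def nondegenerate_metric_def T[symmetric] by blast
  then have "dir a \<phi> u = 0" using a by auto
  then have inj: "dir a \<phi> u = dir 0 \<phi> u"
    using linear_0[OF dir_linear_arg[OF C u]] by simp
  \<comment> \<open>Nondegeneracy on the tangent space only yields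
    \<open>dir a \<phi> u = 0\<close>; the left inverse differential gives
    \<open>a = 0\<close>.\<close>
  obtain F where "\<forall>a. dir (dir a \<phi> u) F (\<phi> u) = a"
    using local_param_left_inverse[OF \<phi> u] by blast
  then show "a = 0" using inj by metis
qed

lemma second_fundamental_form_local_param:
  assumes \<nu>: "unit_normal_field S M \<epsilon> \<nu>" and \<phi>: "local_param M U \<phi>" and u: "u \<in> U"
  shows "second_fundamental_form S M \<nu> (\<phi> u) (dir a \<phi> u) (dir b \<phi> u) =
    - \<epsilon> * pmetric S (dir a (\<lambda>u. \<nu> (\<phi> u)) u) (dir b \<phi> u)"
proof -
  have sm: "smooth_on M \<nu>" and e: "\<epsilon> \<in> {1, -1}" "pmetric S (\<nu> (\<phi> u)) (\<nu> (\<phi> u)) = \<epsilon>"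
    using \<nu> local_param_image[OF \<phi> u] by (auto simp: unit_normal_field_def)
  then show ?thesis
    unfolding second_fundamental_form_def frechet_derivative_within_local_param[OF \<phi> u sm] by auto
qed

text \<open>Preserving a nondegenerate product makes \<open>T\<close> injective, hence bijective,
  and the inverse map is again affine.\<close>

lemma motion_affine:
  fixes T :: "real ^ 'N::finite \<Rightarrow> real ^ 'N"
  assumes T: "linear T" and iso: "\<And>v w. pmetric S (T v) (T w) = pmetric S v w"
  shows "motion S (\<lambda>x. T x + c)"
proof -
  have "inj T"
  proof (rule linear_injective_0[OF T, THEN iffD2], intro allI impI)
    fix x assume "T x = 0"
    then have "pmetric S x y = 0" for y using iso[of x y] by (simp add: pmetric_simps)
    then show "x = 0" by (rule pmetric_nondegenerate)
  qed
  then have bij: "bij T" using linear_injective_imp_surjective[OF T] by (simp add: bij_def)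
  then obtain T' where T': "linear T'" "\<And>x. T' (T x) = x" "\<And>x. T (T' x) = x"
    using linear_injective_isomorphism[OF T \<open>inj T\<close>] by blast
  have bij': "bij (\<lambda>x. T x + c)"
    by (rule o_bij[of "\<lambda>y. T' (y - c)"]) (auto simp: fun_eq_iff T')
  have sm: "smooth_on UNIV (\<lambda>x. L x + d)" if "linear L" for L :: "real ^ 'N \<Rightarrow> real ^ 'N" and d
    unfolding smooth_on_open[OF open_UNIV]
    by (intro C_inf_on_add C_inf_on_const open_UNIV) (use that in \<open>simp add: linear_conv_bounded_linear C_inf_on_linear\<close>)
  have "inv (\<lambda>x. T x + c) = (\<lambda>y. T' y + - T' c)"
  proof
    fix y
    have "T (T' y + - T' c) + c = y" by (simp add: linear_diff[OF T] T')
    then show "inv (\<lambda>x. T x + c) y = T' y + - T' c"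
      using inv_f_eq[OF bij_is_inj[OF bij']] by blast
  qed
  then have d: "diffeomorphism UNIV UNIV (\<lambda>x. T x + c)"
    using bij' sm[OF T] sm[OF T'(1), of "- T' c"] by (simp add: diffeomorphism_def)
  have "((\<lambda>x. T x + c) has_derivative T) (at p)" for p
    using T by (auto intro!: derivative_eq_intros bounded_linear.has_derivative[of T] simp: linear_conv_bounded_linear)
  then have "frechet_derivative (\<lambda>x. T x + c) (at p) = T" for p
    using frechet_derivative_at by metis
  then show ?thesis using d iso by (simp add: motion_def)
qed

text \<open>Density passes to the parameter domain because charts map open sets to relatively open
  sets.\<close>

lemma nonumbilic_dense_param:
  assumes \<phi>: "local_param M U \<phi>" and dense: "M \<subseteq> closure {q \<in> M. Q q}"
  shows "U \<subseteq> closure {u \<in> U. Q (\<phi> u)}"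
proof
  fix u assume u: "u \<in> U"
  have U: "open U" using \<phi> by (simp add: local_param_def)
  show "u \<in> closure {u \<in> U. Q (\<phi> u)}"
  proof (rule closure_iff_nhds_not_empty[THEN iffD2], intro allI impI)
    fix A V assume "V \<subseteq> A" "open V" "u \<in> V"
    then have V: "open (V \<inter> U)" "u \<in> V \<inter> U" using U u by auto
    obtain O' where O': "open O'" "\<phi> ` (V \<inter> U) = M \<inter> O'"
      using local_param_open_image[OF \<phi> V(1)] by (auto simp: openin_open)
    have "\<phi> u \<in> O'" using O'(2) V by blast
    moreover have "\<phi> u \<in> closure {q \<in> M. Q q}" using dense local_param_image[OF \<phi> u] by blast
    ultimately have "O' \<inter> {q \<in> M. Q q} \<noteq> {}"
      using open_Int_closure_eq_empty[OF O'(1)] by blast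
    then obtain q where q: "q \<in> O'" "q \<in> M" "Q q" by blast
    then have "q \<in> \<phi> ` (V \<inter> U)" using O'(2) by blast
    then show "{u \<in> U. Q (\<phi> u)} \<inter> A \<noteq> {}" using q \<open>V \<subseteq> A\<close> by blast
  qed
qed

section \<open>Bending preserving diffeomorphisms\<close>

theorem theorem2:
  fixes S :: "'N::finite set"
    and M M' :: "(real ^ 'N) set"
    and \<nu> \<nu>' :: "real ^ 'N \<Rightarrow> real ^ 'N"
    and \<epsilon> :: real
    and f :: "real ^ 'N \<Rightarrow> real ^ 'N"
    and p :: "real ^ 'N"
  assumes "CARD('n::finite) > 2"
    and "hypersurface TYPE('n) S M" and "hypersurface TYPE('n) S M'"
    and "indefinite_metric S M" and "indefinite_metric S M'"
    and "unit_normal_field S M \<epsilon> \<nu>" and "unit_normal_field S M' \<epsilon> \<nu>'"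
    and "diffeomorphism M M' f"
    and "bending_preserving S M \<nu> M' \<nu>' f"
    and "M \<subseteq> closure {q \<in> M. \<not> umbilic S M \<nu> q}"
    and "p \<in> M"
    and "\<exists>X\<in>tangent_space M p. \<exists>Y\<in>tangent_space M p.
         \<exists>Z\<in>tangent_space M p. \<exists>W\<in>tangent_space M p.
           curvature_tensor TYPE('n) S M p X Y Z W \<noteq> 0"
  shows "\<exists>V. openin (top_of_set M) V \<and> p \<in> V \<and> congruence S V (f ` V) f"
proof -
  note dim = assms(1) and M = assms(2) and M' = assms(3) and indef = assms(4)
    and \<nu> = assms(6) and \<nu>' = assms(7) and f = assms(8) and bend = assms(9)
    and dense = assms(10) and p = assms(11) and curved = assms(12)
  \<comment> \<open>Working in the chart chosen in \<open>curvature_tensor\<close> avoids a proof that the tensor does not depend on it.\<close>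
  obtain U :: "(real ^ 'n) set" and \<phi> where U\<phi>:
    "(SOME (U :: (real ^ 'n) set, \<phi>). local_param M U \<phi> \<and> p \<in> \<phi> ` U) = (U, \<phi>)"
    by fastforce
  have "\<exists>x. case x of (U :: (real ^ 'n) set, \<phi>) \<Rightarrow> local_param M U \<phi> \<and> p \<in> \<phi> ` U"
    using M p by (auto simp: hypersurface_def)
  from someI_ex[OF this] have \<phi>: "local_param M U \<phi>" and pU: "p \<in> \<phi> ` U"
    unfolding U\<phi> by auto
  define u0 where "u0 = inv_into U \<phi> p"
  have u0: "u0 \<in> U" "\<phi> u0 = p" using pU by (auto simp: u0_def inv_into_into f_inv_into_f)
  define Y where "Y = (\<lambda>u. f (\<phi> u))"
  define n where "n = (\<lambda>u. \<nu> (\<phi> u))"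
  define m where "m = (\<lambda>u. \<nu>' (f (\<phi> u)))"
  have Y: "local_param M' U Y" unfolding Y_def by (rule local_param_compose[OF \<phi> f])
  interpret X: patch S U \<phi> n \<epsilon>
    unfolding n_def by (rule patch_local_param[OF M \<nu> \<phi>])
  interpret Y: patch S U Y m \<epsilon>
    using patch_local_param[OF M' \<nu>' Y] by (simp add: m_def Y_def)

  have X2: "second_fundamental_form S M \<nu> (\<phi> u) (dir a \<phi> u) (dir b \<phi> u) = X.I2 u a b" if "u \<in> U" for u a b
    unfolding X.I2_def unfolding n_def by (rule second_fundamental_form_local_param[OF \<nu> \<phi> that])
  have Y2: "second_fundamental_form S M' \<nu>' (f (\<phi> u)) (dir a Y u) (dir b Y u) = Y.I2 u a b" if "u \<in> U" for u a b
    unfolding Y.I2_def using second_fundamental_form_local_param[OF \<nu>' Y that] by (simp add: m_def Y_def)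
  have push: "pushforward M f (\<phi> u) (dir a \<phi> u) = dir a Y u" if "u \<in> U" for u a
    using frechet_derivative_within_local_param[OF \<phi> that, of f a] f
    by (simp add: pushforward_def diffeomorphism_def Y_def)
  have umb: "umbilic S M \<nu> (\<phi> u) \<longleftrightarrow> (\<exists>\<alpha>. \<forall>a b. X.I2 u a b = \<alpha> * X.I1 u a b)" if "u \<in> U" for u
    by (simp add: umbilic_def tangent_space_local_param[OF \<phi> that] X2 that X.I1_def)

  define D where "D = {u \<in> U. \<not> (\<exists>\<alpha>. \<forall>a b. X.I2 u a b = \<alpha> * X.I1 u a b)}"
  have "D = {u \<in> U. \<not> umbilic S M \<nu> (\<phi> u)}" using umb by (auto simp: D_def)
  then have D: "U \<subseteq> closure D" using nonumbilic_dense_param[OF \<phi> dense] by simp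

  have pos: "\<exists>a. X.I1 u a a > 0" and neg: "\<exists>a. X.I1 u a a < 0" if "u \<in> U" for u
    using indef local_param_image[OF \<phi> that]
    by (auto simp: indefinite_metric_def X.I1_def tangent_space_local_param[OF \<phi> that] dest!: bspec[of M _ "\<phi> u"])

  have proportional: "\<exists>r. (\<forall>a b. Y.I1 u a b = r * X.I1 u a b) \<and> (\<forall>a b. Y.I2 u a b = r * X.I2 u a b)"
    if "u \<in> D" for u
  proof -
    have u: "u \<in> U" using that by (simp add: D_def)
    obtain a b where ab: "X.I1 u a a > 0" "X.I1 u b b < 0" using pos neg u by blast
    interpret pseudo_scalar_product "X.I1 u" by (rule X.pseudo_scalar_product_I1[OF u])
    show ?thesis
    proof (rule same_bending_imp_proportional[OF _ ab X.sym_form_I2[OF u] Y.sym_form_I2[OF u]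
          Y.pseudo_scalar_product_I1[OF u]])
      show "DIM(real ^ 'n) > 2" using dim by simp
      show "\<not> (\<exists>\<alpha>. \<forall>x y. X.I2 u x y = \<alpha> * X.I1 u x y)" using that by (simp add: D_def)
      fix a assume a: "X.I1 u a a \<noteq> 0" "Y.I1 u a a \<noteq> 0"
      then have "dir a \<phi> u \<noteq> 0" by (auto simp: X.I1_def pmetric_simps)
      moreover have "dir a \<phi> u \<in> tangent_space M (\<phi> u)"
        by (simp add: tangent_space_local_param[OF \<phi> u])
      ultimately have "bending S M' \<nu>' (f (\<phi> u)) (dir a Y u) = bending S M \<nu> (\<phi> u) (dir a \<phi> u)"
        using bend a local_param_image[OF \<phi> u] push[OF u, of a]
        unfolding bending_preserving_def isotropic_def X.I1_def Y.I1_def by metis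
      then show "Y.I2 u a a / Y.I1 u a a = X.I2 u a a / X.I1 u a a"
        by (simp add: bending_def X2 Y2 u X.I1_def Y.I1_def)
    qed
  qed

  \<comment> \<open>A nonnull direction, kept fixed: the conformal factor will be read off from its
    squares in the two metrics.\<close>
  obtain a0 where a0: "X.I1 u0 a0 a0 \<noteq> 0" using pos[OF u0(1)] by (metis less_irrefl)

  obtain i j k l where "riemann (induced_metric S \<phi>) i j k l u0 \<noteq> 0"
  proof (rule ccontr)
    assume "\<not> thesis"
    then have "riemann (induced_metric S \<phi>) i j k l u0 = 0" for i j k l using that by blast
    then show False using curved by (simp add: curvature_tensor_def U\<phi> u0_def[symmetric])
  qed
  then have K0: "X.I2 u0 (axis j 1) (axis k 1) * X.I2 u0 (axis i 1) (axis l 1)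
      - X.I2 u0 (axis i 1) (axis k 1) * X.I2 u0 (axis j 1) (axis l 1) \<noteq> 0"
    by (simp add: X.riemann_eq u0)

  \<comment> \<open>One function for two open conditions: where it is nonzero, \<open>I2\<close> has
    rank at least two and \<open>a0\<close> is nonnull. A ball also provides the connectedness that
    \<open>rigidity\<close> requires.\<close>
  define R where "R u = (X.I2 u (axis j 1) (axis k 1) * X.I2 u (axis i 1) (axis l 1)
      - X.I2 u (axis i 1) (axis k 1) * X.I2 u (axis j 1) (axis l 1)) * X.I1 u a0 a0" for u
  have "continuous_on U R"
    unfolding R_def
    by (intro continuous_intros C_inf_on_continuous X.smooth_I1 X.smooth_I2)
  then have "open {u \<in> U. R u \<noteq> 0}"
    using continuous_open_preimage[OF _ X.open_U open_Compl[OF closed_singleton[of 0]]]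
    by (simp add: vimage_def Int_def)
  moreover have "u0 \<in> {u \<in> U. R u \<noteq> 0}" using u0 K0 a0 by (simp add: R_def)
  ultimately obtain e where e: "e > 0" "ball u0 e \<subseteq> {u \<in> U. R u \<noteq> 0}"
    using open_contains_ball by metis
  define B where "B = ball u0 e"
  have B: "open B" "connected B" "B \<subseteq> U" "u0 \<in> B" and RB: "\<And>u. u \<in> B \<Longrightarrow> R u \<noteq> 0"
    using e by (auto simp: B_def)

  \<comment> \<open>The factors from \<open>proportional\<close> are chosen point by point, only on
    \<open>D\<close> and without regularity. This quotient is smooth on all of \<open>B\<close> and
    equals them on \<open>D\<close>, so the two proportionalities extend by continuity.\<close>
  define L where "L u = Y.I1 u a0 a0 / X.I1 u a0 a0" for u
  have L: "C_inf_on B L"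
    unfolding L_def
    by (intro C_inf_on_divide C_inf_on_subset[OF X.smooth_I1 B(3,1)] C_inf_on_subset[OF Y.smooth_I1 B(3,1)])
      (use RB in \<open>auto simp: R_def\<close>)
  have BD: "B \<subseteq> closure D" using B D by blast
  have onD: "Y.I1 u a b = L u * X.I1 u a b" "Y.I2 u a b = L u * X.I2 u a b" if "u \<in> D" "u \<in> B" for u a b
  proof -
    obtain r where r: "\<forall>a b. Y.I1 u a b = r * X.I1 u a b" "\<forall>a b. Y.I2 u a b = r * X.I2 u a b"
      using proportional[OF \<open>u \<in> D\<close>] by blast
    have "X.I1 u a0 a0 \<noteq> 0" using RB[OF \<open>u \<in> B\<close>] by (auto simp: R_def)
    then have "L u = r" using r(1) by (simp add: L_def)
    then show "Y.I1 u a b = L u * X.I1 u a b" "Y.I2 u a b = L u * X.I2 u a b" using r by auto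
  qed
  have onB: "Y.I1 u a b = L u * X.I1 u a b" "Y.I2 u a b = L u * X.I2 u a b" if "u \<in> B" for u a b
  proof -
    have c: "continuous_on B L" "continuous_on B (\<lambda>u. X.I1 u a b)" "continuous_on B (\<lambda>u. X.I2 u a b)"
      "continuous_on B (\<lambda>u. Y.I1 u a b)" "continuous_on B (\<lambda>u. Y.I2 u a b)"
      by (rule C_inf_on_continuous, rule L C_inf_on_subset[OF X.smooth_I1 B(3,1)]
          C_inf_on_subset[OF X.smooth_I2 B(3,1)] C_inf_on_subset[OF Y.smooth_I1 B(3,1)]
          C_inf_on_subset[OF Y.smooth_I2 B(3,1)])+
    have "Y.I1 u a b - L u * X.I1 u a b = 0"
      by (rule zero_on_dense[OF B(1) _ BD _ that]) (use c onD in \<open>auto intro!: continuous_intros\<close>)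
    then show "Y.I1 u a b = L u * X.I1 u a b" by simp
    have "Y.I2 u a b - L u * X.I2 u a b = 0"
      by (rule zero_on_dense[OF B(1) _ BD _ that]) (use c onD in \<open>auto intro!: continuous_intros\<close>)
    then show "Y.I2 u a b = L u * X.I2 u a b" by simp
  qed

  interpret P: patch_pair S B \<phi> n Y m \<epsilon> L
    by (intro patch_pair.intro X.restrict Y.restrict B patch_pair_axioms.intro L onB)

  \<comment> \<open>Density is needed relative to the smaller domain; it survives because
    \<open>B\<close> is open.\<close>
  have dB: "B \<subseteq> closure {u \<in> B. \<not> (\<exists>\<alpha>. \<forall>a b. X.I2 u a b = \<alpha> * X.I1 u a b)}"
  proof -
    have "B \<inter> closure D \<subseteq> closure (B \<inter> D)" by (rule open_Int_closure_subset[OF B(1)])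
    moreover have "B \<inter> D \<subseteq> {u \<in> B. \<not> (\<exists>\<alpha>. \<forall>a b. X.I2 u a b = \<alpha> * X.I1 u a b)}"
      by (auto simp: D_def)
    ultimately show ?thesis using BD closure_mono by blast
  qed
  have L1: "L u = 1" if "u \<in> B" for u
  proof (rule P.conformal_factor_eq_1[OF dB _ that])
    fix u assume "u \<in> B"
    then show "\<exists>a b c d. X.I2 u b c * X.I2 u a d - X.I2 u a c * X.I2 u b d \<noteq> 0"
      using RB unfolding R_def by (metis mult_zero_left)
  qed
  obtain T c where T: "linear T" "\<And>v w. pmetric S (T v) (T w) = pmetric S v w"
    "\<And>u. u \<in> B \<Longrightarrow> Y u = T (\<phi> u) + c"
    using P.rigidity[OF L1 B(2)] by blast

  have V: "openin (top_of_set M) (\<phi> ` B)" by (rule local_param_open_image[OF \<phi> B(1,3)])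
  then have "diffeomorphism (\<phi> ` B) (f ` \<phi> ` B) f"
    by (intro diffeomorphism_restrict[OF f] openin_imp_subset)
  moreover have "\<forall>x\<in>\<phi> ` B. T x + c = f x" using T(3) by (auto simp: Y_def)
  ultimately have "congruence S (\<phi> ` B) (f ` \<phi> ` B) f"
    using motion_affine[OF T(1,2), of c] unfolding congruence_def by blast
  moreover have "p \<in> \<phi> ` B" using u0(2) B(4) by blast
  ultimately show ?thesis using V by blast
qed

end
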